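(* Consider loops (composite of elementary canonical maps followed by the inverse canonical map of the endpoint medium) with holonomy $D=\rho\begin{pmatrix}1&0\\0&R\end{pmatrix}$, acting on far-field directivities ($d=3$) by $I_2(\boldsymbol n,\omega)=I_1(R^{\mathrm T}\boldsymbol n,\rho\omega)$. (i) Anisotropy loops. For loops composed of anisotropy steps at zero velocity, $W=w_3(\boldsymbol 0,C_n)\cdots w_3(\boldsymbol 0,C_1)$ with $C_i\succ0$, every elementary map has time row $(1,\boldsymbol 0^{\mathrm T})$, so $\rho=1$ exactly: the loop acts as a pure rigid rotation of the directivity pattern, leaving spectra untouched, $I_2(\boldsymbol n,\omega)=I_1(R^{\mathrm T}\boldsymbol n,\omega)$. (ii) Boost loops. For loops composed of boost steps, $W=w(\boldsymbol u_n)\cdots w(\boldsymbol u_1)$ with admissible endpoint, $R=I+O(M^4)$ as $M:=\max_i|\boldsymbol u_i|/c\to0$ ($n$ fixed): to fourth order the loop acts as a pure rigid spectral dilation by $\rho$, leaving directivity untouched.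
   Context: Fix $c>0$; coordinates $(t,\boldsymbol x)\in\mathbb R^{1+d}$, index $0$ for $t$; $Q_*=\begin{pmatrix}1&0\\0&-c^2I\end{pmatrix}$. For $(\boldsymbol v,C)$ admissible ($C$ symmetric, $A=C-\boldsymbol v\boldsymbol v^{\mathrm T}\succ0$) put $Q(\boldsymbol v,C)=\begin{pmatrix}1&\boldsymbol v^{\mathrm T}\\ \boldsymbol v&\boldsymbol v\boldsymbol v^{\mathrm T}-C\end{pmatrix}$ and $w_3(\boldsymbol v,C)=\begin{pmatrix}p&\boldsymbol q^{\mathrm T}\\0&S\end{pmatrix}$, $S=cA^{-1/2}$, $p=(1+\boldsymbol v^{\mathrm T}A^{-1}\boldsymbol v)^{-1/2}$, $\boldsymbol q=pA^{-1}\boldsymbol v$; it satisfies $w_3Q(\boldsymbol v,C)w_3^{\mathrm T}=Q_*$. For $|\boldsymbol v|<c$, $w(\boldsymbol v)=w_3(\boldsymbol v,c^2I)$. For a composite $W$ of such maps, $Q_{\mathrm{end}}=W^{-1}Q_*W^{-\mathrm T}$, $q_{00}=(Q_{\mathrm{end}})_{00}$; the endpoint is admissible if $q_{00}>0$ and $Q_{\mathrm{end}}/q_{00}=Q(\boldsymbol v,C)$ with $(\boldsymbol v,C)$ admissible. The holonomy is $D=W\,w_3(\boldsymbol v,C)^{-1}$, which has the form $\rho\begin{pmatrix}1&0\\0&R\end{pmatrix}$ with $\rho=q_{00}^{-1/2}$, $R\in SO(d)$. Directivity: with source spectrum $\Phi(\omega,\boldsymbol k)$ in the quiescent medium, $I(\boldsymbol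 n,\omega)=K\Phi(\omega,\frac\omega c\boldsymbol n)$, $K>0$ constant, $\boldsymbol n$ a unit vector; $I_1$, $I_2$ are the directivities predicted from the original source model and from its transport $s\mapsto\rho^{-2}s\circ D^{-1}$. *)

theory Defs
  imports "HOL-Probability.Probability"
begin

section \<open>Media and canonical maps\<close>

text \<open>
  Space-time indices form the type \<open>'d option\<close>: \<open>None\<close> is the time index and \<open>Some i\<close> are
  the space indices, so \<open>d = CARD('d)\<close>. The arguments of \<open>block_matrix\<close> are, in this order,
  the time-time entry, the upper right row, the lower left column and the spatial block.
\<close>

definition block_matrix ::
    "real \<Rightarrow> real^'d \<Rightarrow> real^'d \<Rightarrow> real^'d^'d \<Rightarrow> real^('d option)^('d option)" where
  "block_matrix a r l B = (\<chi> i j.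
     (case i of
        None \<Rightarrow> (case j of None \<Rightarrow> a | Some j' \<Rightarrow> r $ j')
      | Some i' \<Rightarrow> (case j of None \<Rightarrow> l $ i' | Some j' \<Rightarrow> B $ i' $ j')))"

definition outer :: "real^'d \<Rightarrow> real^'d^'d" where
  "outer v = (columnvector v :: real^1^'d) ** rowvector v"

definition pos_def :: "real^'d^'d \<Rightarrow> bool" where
  "pos_def A \<longleftrightarrow> transpose A = A \<and> (\<forall>x. x \<noteq> 0 \<longrightarrow> x \<bullet> (A *v x) > 0)"

definition pd_sqrt :: "real^'d^'d \<Rightarrow> real^'d^'d" where
  "pd_sqrt A = (THE B. pos_def B \<and> B ** B = A)"

definition admissible_medium :: "real^'d \<Rightarrow> real^'d^'d \<Rightarrow> bool" where
  "admissible_medium v C \<longleftrightarrow> transpose C = C \<and> pos_def (C - outer v)"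

definition Q_matrix :: "real^'d \<Rightarrow> real^'d^'d \<Rightarrow> real^('d option)^('d option)" where
  "Q_matrix v C = block_matrix 1 v v (outer v - C)"

definition Q_star :: "real \<Rightarrow> real^('d::finite option)^('d option)" where
  "Q_star c = block_matrix 1 0 0 (- mat (c\<^sup>2))"

definition w3 :: "real \<Rightarrow> real^'d \<Rightarrow> real^'d^'d \<Rightarrow> real^('d option)^('d option)" where
  "w3 c v C =
     (let A = C - outer v;
          a = matrix_inv A *v v;
          p = 1 / sqrt (1 + v \<bullet> a)
      in block_matrix p (p *\<^sub>R a) 0 (c *\<^sub>R matrix_inv (pd_sqrt A)))"

definition boost :: "real \<Rightarrow> real^'d \<Rightarrow> real^('d option)^('d option)" where
  "boost c u = w3 c u (mat (c\<^sup>2))"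


section \<open>Loops and their holonomy\<close>

text \<open>The list is in order of application: \<open>composite [W\<^sub>1, \<dots>, W\<^sub>n] = W\<^sub>n ** \<dots> ** W\<^sub>1\<close>.\<close>

definition composite :: "(real^'k^'k) list \<Rightarrow> real^'k^'k" where
  "composite Ws = fold (**) Ws (mat 1)"

definition Q_end :: "real \<Rightarrow> real^('d::finite option)^('d option) \<Rightarrow> real^('d option)^('d option)" where
  "Q_end c W = matrix_inv W ** Q_star c ** transpose (matrix_inv W)"

definition q00 :: "real \<Rightarrow> real^('d::finite option)^('d option) \<Rightarrow> real" where
  "q00 c W = Q_end c W $ None $ None"

text \<open>\<open>endpoint c W v C\<close>: the endpoint of \<open>W\<close> is admissible, and its medium is \<open>(v, C)\<close>.\<close>

definition endpoint ::
    "real \<Rightarrow> real^('d option)^('d option) \<Rightarrow> real^'d \<Rightarrow> real^'d^'d \<Rightarrow> bool" where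
  "endpoint c W v C \<longleftrightarrow>
     q00 c W > 0 \<and> admissible_medium v C \<and> (1 / q00 c W) *\<^sub>R Q_end c W = Q_matrix v C"

definition holonomy ::
    "real \<Rightarrow> real^('d option)^('d option) \<Rightarrow> real^'d \<Rightarrow> real^'d^'d \<Rightarrow> real^('d option)^('d option)" where
  "holonomy c W v C = W ** matrix_inv (w3 c v C)"

definition rho :: "real \<Rightarrow> real^('d::finite option)^('d option) \<Rightarrow> real" where
  "rho c W = 1 / sqrt (q00 c W)"


section \<open>Sources, spectra and directivities\<close>

text \<open>
  A source model is a random field \<open>s y\<close> on space-time, second-order stationary in time and
  space, with integrable autocorrelation. Its spectrum \<open>\<Phi>(\<omega>, k)\<close> is the spectral density,
  i.e. the Fourier transform of the autocorrelation at wave number \<open>k\<close> and angular frequency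
  \<open>\<omega>\<close>. It is a quadratic quantity, so that an amplitude factor \<open>a\<close> multiplies it by \<open>a\<^sup>2\<close>, and a
  change of variables by \<open>D\<close> by \<open>\<bar>det D\<bar>\<close> only, not by its square.
\<close>

definition autocorrelation ::
    "'w measure \<Rightarrow> (real^('d::finite option) \<Rightarrow> 'w \<Rightarrow> real) \<Rightarrow> real^('d option) \<Rightarrow> real" where
  "autocorrelation M s h = (\<integral>x. s h x * s 0 x \<partial>M)"

definition stationary_source ::
    "'w measure \<Rightarrow> (real^('d::finite option) \<Rightarrow> 'w \<Rightarrow> real) \<Rightarrow> bool" where
  "stationary_source M s \<longleftrightarrow>
     prob_space M \<and>
     (\<forall>y. s y \<in> borel_measurable M \<and> integrable M (\<lambda>x. (s y x)\<^sup>2)) \<and>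
     (\<forall>y h. (\<integral>x. s (y + h) x * s y x \<partial>M) = autocorrelation M s h) \<and>
     integrable lborel (autocorrelation M s)"

text \<open>
  The transform is real because the autocorrelation is even, so \<open>Re\<close> loses nothing. Any other
  normalisation of the transform is absorbed by the constant \<open>K\<close> of \<open>directivity\<close>.
\<close>

definition spectrum ::
    "'w measure \<Rightarrow> (real^('d option) \<Rightarrow> 'w \<Rightarrow> real) \<Rightarrow> real \<Rightarrow> real^'d \<Rightarrow> real" where
  "spectrum M s \<omega> k =
     Re (\<integral>h. complex_of_real (autocorrelation M s h) *
              cis (\<omega> * h $ None - k \<bullet> (\<chi> i. h $ Some i)) \<partial>lborel) / (2 * pi) ^ (CARD('d) + 1)"

definition directivity ::
    "real \<Rightarrow> real \<Rightarrow> 'w measure \<Rightarrow> (real^('d option) \<Rightarrow> 'w \<Rightarrow> real) \<Rightarrow> real^'d \<Rightarrow> real \<Rightarrow> real" where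
  "directivity K c M s n \<omega> = K * spectrum M s \<omega> ((\<omega> / c) *\<^sub>R n)"

definition transport ::
    "real \<Rightarrow> real^('d::finite option)^('d option) \<Rightarrow> (real^('d option) \<Rightarrow> 'w \<Rightarrow> real) \<Rightarrow>
     (real^('d option) \<Rightarrow> 'w \<Rightarrow> real)" where
  "transport r D s = (\<lambda>y x. (1 / r\<^sup>2) * s (matrix_inv D *v y) x)"

end

theory Submission
  imports Defs
begin

text \<open>
  All elementary maps are block upper triangular with positive time entry and spatial block of
  positive determinant, hence so is the holonomy \<open>D\<close>. Moreover \<open>D Q\<^sub>* D\<^sup>T = \<rho>\<^sup>2 Q\<^sub>*\<close>, and for a
  triangular matrix this forces \<open>D = \<rho> diag(1, R)\<close> with \<open>R\<close> orthogonal. The directivity law is the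
  substitution \<open>h \<mapsto> D h\<close> in the Fourier integral.

  For boosts with \<open>b\<^sub>i = u\<^sub>i / c\<close>, the spatial block of the composite is
  \<open>S = \<Prod> (1 - b\<^sub>i b\<^sub>i\<^sup>T)\<^sup>-\<^sup>1\<^sup>/\<^sup>2 = 1 + \<Sum> b\<^sub>i b\<^sub>i\<^sup>T / 2 + O(M\<^sup>4)\<close>, which is symmetric up to \<open>O(M\<^sup>4)\<close>.
  Since \<open>S = R P\<close> with \<open>P\<close> positive definite, \<open>R\<close> is the orthogonal polar factor of \<open>S\<close>, so it
  differs from the identity by \<open>O(M\<^sup>4)\<close> only.
\<close>

subsection \<open>Frobenius norm and positive definite matrices\<close>

text \<open>The endpoint medium of a boost loop is given implicitly, and its dependence on the
  velocities is never expanded. It enters \<open>S = R P\<close> only through \<open>P\<close>, a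
  positive multiple of \<open>(C - outer v)^(-1/2)\<close>, whose smallest eigenvalue has no uniform
  bound at hand. The lower bound 1 of the symmetric approximant of \<open>S\<close> makes up for
  this, which is why the final constant does not depend on the endpoint. Uniqueness and stability of
  square roots come from one identity, \<open>P^2 - T^2 = P (P - T) + (P - T) T\<close>, paired with
  \<open>P - T\<close> in the Frobenius inner product. The order 4 has its origin in
  noncommutativity: the second-order terms of the boosts add up to the same symmetric matrix in
  whatever order they are applied, and products of two such terms are already of order 4. An
  estimate of \<open>R\<close> alone says nothing about a rough directivity pattern, hence the
  Lipschitz form of the last bound.\<close>

lemma matrix_inv_eqI:
  fixes A B :: "real^'n^'n"
  assumes "A ** B = mat 1"
  shows "matrix_inv A = B"
proof -
  have "A ** matrix_inv A = mat 1 \<and> matrix_inv A ** A = mat 1"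
    unfolding matrix_inv_def
    by (rule someI[where x = B]) (use assms matrix_left_right_inverse in blast)
  then show ?thesis
    by (metis assms matrix_mul_assoc matrix_mul_lid matrix_mul_rid)
qed

lemma matrix_add_rdistrib: "(A + B) ** C = A ** C + B ** (C :: real^'k^'n)"
  by (simp add: matrix_matrix_mult_def vec_eq_iff distrib_right sum.distrib)

lemma matrix_diff_ldistrib: "A ** (B - C) = A ** B - A ** (C :: real^'k^'n)"
  by (simp add: matrix_matrix_mult_def vec_eq_iff right_diff_distrib sum_subtractf)

lemma matrix_diff_rdistrib: "(A - B) ** C = A ** C - B ** (C :: real^'k^'n)"
  by (simp add: matrix_matrix_mult_def vec_eq_iff left_diff_distrib sum_subtractf)

text \<open>The inner product of this type is the Frobenius one, the trace of
  \<open>transpose X ** Y\<close>. Splitting it by columns turns bounds on \<open>A *v x\<close>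
  into bounds on \<open>A ** B\<close>.\<close>

lemma inner_eq_sum_columns:
  fixes X Y :: "real^'n^'m"
  shows "X \<bullet> Y = (\<Sum>j\<in>UNIV. column j X \<bullet> column j Y)"
  unfolding inner_vec_def by (subst sum.swap) (simp add: column_def)

lemma inner_transpose: "transpose X \<bullet> transpose Y = X \<bullet> (Y :: real^'n^'m)"
  unfolding inner_vec_def by (subst sum.swap) (simp add: transpose_def)

lemma norm_transpose: "norm (transpose X) = norm (X :: real^'n^'m)"
  by (simp add: norm_eq_sqrt_inner inner_transpose)

lemma column_matrix_mult: "column j (A ** B) = A *v column j (B :: real^'n^'m)"
  by (simp add: column_def matrix_matrix_mult_def matrix_vector_mult_def vec_eq_iff)

lemma norm_matrix_vector_mult_le: "norm (A *v x) \<le> norm A * norm (x :: real^'n)"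
proof -
  have "(norm (A *v x))\<^sup>2 = (\<Sum>i\<in>UNIV. (A $ i \<bullet> x)\<^sup>2)"
    unfolding power2_norm_eq_inner by (simp add: inner_vec_def matrix_vector_mult_def power2_eq_square)
  also have "\<dots> \<le> (\<Sum>i\<in>UNIV. (norm (A $ i))\<^sup>2 * (norm x)\<^sup>2)"
    by (intro sum_mono) (metis Cauchy_Schwarz_ineq power2_norm_eq_inner)
  also have "\<dots> = (norm A * norm x)\<^sup>2"
    by (simp add: power_mult_distrib sum_distrib_right[symmetric] power2_norm_eq_inner inner_vec_def)
  finally show ?thesis
    by (rule power2_le_imp_le) simp
qed

text \<open>Sharper than submultiplicativity of the Frobenius norm: \<open>r\<close> bounds the
  operator norm, so a contraction keeps its factor below 1 and an orthogonal matrix gets the factor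
  1 instead of its Frobenius norm.\<close>

lemma norm_matrix_mult_left_le:
  fixes A :: "real^'n^'m" and B :: "real^'k^'n"
  assumes "\<And>x. norm (A *v x) \<le> r * norm x"
  shows "norm (A ** B) \<le> r * norm B"
proof -
  have r: "0 \<le> r"
    using order_trans[OF norm_ge_zero assms[of "axis undefined 1"]] by simp
  have "(norm (A ** B))\<^sup>2 = (\<Sum>j\<in>UNIV. (norm (A *v column j B))\<^sup>2)"
    by (simp add: power2_norm_eq_inner inner_eq_sum_columns column_matrix_mult)
  also have "\<dots> \<le> (\<Sum>j\<in>UNIV. (r * norm (column j B))\<^sup>2)"
    by (intro sum_mono power_mono assms) simp
  also have "\<dots> = (r * norm B)\<^sup>2"
    by (simp add: power_mult_distrib sum_distrib_left[symmetric])
      (simp add: power2_norm_eq_inner inner_eq_sum_columns)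
  finally show ?thesis
    by (rule power2_le_imp_le) (simp add: r)
qed

lemma norm_matrix_mult_le: "norm (A ** B) \<le> norm A * norm (B :: real^'k^'n)"
  by (intro norm_matrix_mult_left_le norm_matrix_vector_mult_le)

lemma inner_matrix_mult_ge:
  fixes P :: "real^'n^'n" and Z :: "real^'m^'n"
  assumes "\<And>x. m * (norm x)\<^sup>2 \<le> x \<bullet> (P *v x)"
  shows "m * (norm Z)\<^sup>2 \<le> Z \<bullet> (P ** Z)"
proof -
  have "m * (norm Z)\<^sup>2 = (\<Sum>j\<in>UNIV. m * (norm (column j Z))\<^sup>2)"
    by (simp add: power2_norm_eq_inner inner_eq_sum_columns sum_distrib_left)
  also have "\<dots> \<le> (\<Sum>j\<in>UNIV. column j Z \<bullet> (P *v column j Z))"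
    by (intro sum_mono assms)
  finally show ?thesis
    by (simp add: inner_eq_sum_columns column_matrix_mult)
qed

lemma inner_matrix_mult_right_ge:
  fixes P :: "real^'n^'n" and Z :: "real^'n^'m"
  assumes "transpose P = P" "\<And>x. m * (norm x)\<^sup>2 \<le> x \<bullet> (P *v x)"
  shows "m * (norm Z)\<^sup>2 \<le> Z \<bullet> (Z ** P)"
proof -
  have "Z \<bullet> (Z ** P) = transpose Z \<bullet> (P ** transpose Z)"
    by (subst inner_transpose[symmetric]) (simp only: matrix_transpose_mul assms(1))
  then show ?thesis
    using inner_matrix_mult_ge[OF assms(2), of "transpose Z"] by (simp add: norm_transpose)
qed

section \<open>Positive definite square roots: uniqueness, stability, existence\<close>

lemma pos_def_coercive:
  fixes A :: "real^'n^'n"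
  assumes "pos_def A"
  obtains m where "m > 0" "\<And>x. m * (norm x)\<^sup>2 \<le> x \<bullet> (A *v x)"
proof -
  let ?f = "\<lambda>x::real^'n. x \<bullet> (A *v x)"
  have "continuous_on (sphere 0 1) ?f"
    by (intro continuous_intros linear_continuous_on) (simp add: linear_linear)
  moreover have "sphere (0::real^'n) 1 \<noteq> {}" by simp
  ultimately obtain e where e: "e \<in> sphere 0 1" "\<And>y. y \<in> sphere 0 1 \<Longrightarrow> ?f e \<le> ?f y"
    using continuous_attains_inf[of "sphere 0 1" ?f] compact_sphere by blast
  have "e \<noteq> 0"
    using e(1) by auto
  then have e0: "?f e > 0"
    using assms unfolding pos_def_def by blast
  \<comment> \<open>By homogeneity the minimum over the compact unit sphere serves as
    \<open>m\<close>.\<close>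
  have "?f e * (norm x)\<^sup>2 \<le> ?f x" for x
  proof (cases "x = 0")
    case False
    then have "?f e \<le> ?f ((1 / norm x) *\<^sub>R x)"
      by (intro e(2)) simp
    then show ?thesis
      using False by (simp add: field_simps power2_eq_square matrix_vector_mult_scaleR)
  qed simp
  then show ?thesis using that e0 by blast
qed

text \<open>With \<open>D = P - T\<close> the difference of squares is
  \<open>P ** D + D ** T\<close>, and its inner product with \<open>D\<close> dominates
  \<open>(a + b) * (norm D)^2\<close>. The constants are kept apart because uniqueness has both of
  them positive, while the polar estimate has only \<open>a = 0\<close> and
  \<open>b = 1\<close>.\<close>

lemma sqrt_perturbation:
  fixes P T :: "real^'n^'n"
  assumes "transpose T = T"
    and "\<And>x. a * (norm x)\<^sup>2 \<le> x \<bullet> (P *v x)"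
    and "\<And>x. b * (norm x)\<^sup>2 \<le> x \<bullet> (T *v x)"
  shows "(a + b) * norm (P - T) \<le> norm (P ** P - T ** T)"
proof (cases "P = T")
  case False
  let ?D = "P - T"
  have "P ** P - T ** T = P ** ?D + ?D ** T"
    by (simp add: matrix_diff_ldistrib matrix_diff_rdistrib)
  then have "?D \<bullet> (P ** P - T ** T) = ?D \<bullet> (P ** ?D) + ?D \<bullet> (?D ** T)"
    by (simp add: inner_add_right)
  then have "(a + b) * (norm ?D)\<^sup>2 \<le> ?D \<bullet> (P ** P - T ** T)"
    using inner_matrix_mult_ge[OF assms(2), of ?D] inner_matrix_mult_right_ge[OF assms(1,3), of ?D]
    by (simp add: algebra_simps)
  also have "\<dots> \<le> norm ?D * norm (P ** P - T ** T)"
    by (rule norm_cauchy_schwarz)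
  finally show ?thesis
    using False by (simp add: power2_eq_square)
qed simp

lemma pos_def_sqrt_unique:
  assumes "pos_def P" "pos_def T" "P ** P = T ** T"
  shows "P = T"
proof -
  obtain a where a: "a > 0" "\<And>x. a * (norm x)\<^sup>2 \<le> x \<bullet> (P *v x)"
    using pos_def_coercive assms by blast
  obtain b where b: "b > 0" "\<And>x. b * (norm x)\<^sup>2 \<le> x \<bullet> (T *v x)"
    using pos_def_coercive assms by blast
  have "(a + b) * norm (P - T) \<le> 0"
    using sqrt_perturbation[of T a P b] a b assms by (simp add: pos_def_def)
  then show ?thesis
    using a(1) b(1) by (simp add: mult_le_0_iff)
qed

lemma transpose_scaleR: "transpose (k *\<^sub>R A) = k *\<^sub>R transpose (A :: real^'n^'m)"
  by (simp add: transpose_def vec_eq_iff)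

lemma transpose_add: "transpose (A + B) = transpose A + transpose (B :: real^'n^'m)"
  by (simp add: transpose_def vec_eq_iff)

lemma transpose_diff: "transpose (A - B) = transpose A - transpose (B :: real^'n^'m)"
  by (simp add: transpose_def vec_eq_iff)

lemma linear_transpose: "linear (transpose :: real^'n^'m \<Rightarrow> real^'m^'n)"
  by (intro linearI) (simp_all add: transpose_scaleR transpose_add)

lemma closed_symmetric_matrices: "closed {Y. transpose Y = (Y :: real^'n^'n)}"
  by (intro closed_Collect_eq linear_continuous_on continuous_on_id)
    (simp add: linear_transpose linear_linear)

lemma closed_matrices_bounded_by:
  "closed {Y :: real^'n^'m. \<forall>x. norm (Y *v x) \<le> r * norm x}"
proof -
  have "linear (\<lambda>Y. Y *v x)" for x :: "real^'n"
    by (intro linearI)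
      (simp_all add: matrix_vector_mult_add_rdistrib scaleR_matrix_vector_assoc)
  then show ?thesis
    by (intro closed_Collect_all closed_Collect_le continuous_intros linear_continuous_on)
      (simp add: linear_linear)
qed

text \<open>
  \<open>mat 1 - Y\<close> is a square root of \<open>mat 1 - X\<close> iff \<open>Y = (X + Y\<^sup>2) / 2\<close>, and for \<open>X\<close> of operator
  norm below 1 the right-hand side is a contraction in the Frobenius norm.
\<close>

lemma symmetric_sqrt_near_identity:
  fixes X :: "real^'n^'n"
  assumes X: "transpose X = X" "\<And>x. norm (X *v x) \<le> q * norm x" and q: "0 \<le> q" "q < 1"
  shows "\<exists>B. pos_def B \<and> B ** B = mat 1 - X"
proof -
  \<comment> \<open>The smaller root of \<open>r^2 - 2 r + q = 0\<close>: the operator-norm ball of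
    radius \<open>r\<close> is mapped into itself, and \<open>r\<close> is also the contraction
    factor.\<close>
  define r where "r = 1 - sqrt (1 - q)"
  have r: "0 \<le> r" "r < 1" "(q + r\<^sup>2) / 2 = r"
    using q by (simp_all add: r_def power2_diff)
  define S where "S = {Y :: real^'n^'n. transpose Y = Y} \<inter> {Y. \<forall>x. norm (Y *v x) \<le> r * norm x}"
  define f where "f Y = (1 / 2) *\<^sub>R (X + Y ** Y)" for Y
  have "uniform_space_class.complete S"
    unfolding S_def complete_eq_closed
    by (intro closed_Int closed_symmetric_matrices closed_matrices_bounded_by)
  moreover have "0 \<in> S"
    by (simp add: S_def r) (simp add: transpose_def vec_eq_iff)
  then have "S \<noteq> {}" by blast
  moreover have "f ` S \<subseteq> S"
  proof safe
    fix Y assume Y: "Y \<in> S"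
    have "norm (f Y *v x) \<le> r * norm x" for x
    proof -
      have "norm (f Y *v x) = norm (X *v x + Y *v (Y *v x)) / 2"
        by (simp add: f_def matrix_vector_mult_add_rdistrib flip: scaleR_matrix_vector_assoc
            matrix_vector_mul_assoc)
      also have "\<dots> \<le> (norm (X *v x) + norm (Y *v (Y *v x))) / 2"
        using norm_triangle_ineq by (intro divide_right_mono) auto
      also have "norm (Y *v (Y *v x)) \<le> r * norm (Y *v x)"
        using Y by (simp add: S_def)
      also have "r * norm (Y *v x) \<le> r * (r * norm x)"
        using Y r by (intro mult_left_mono) (auto simp: S_def)
      also have "(norm (X *v x) + r * (r * norm x)) / 2 \<le> (q * norm x + r * (r * norm x)) / 2"
        using X by simp
      also have "\<dots> = (q + r\<^sup>2) / 2 * norm x"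
        by (simp add: algebra_simps power2_eq_square)
      finally show ?thesis using r by simp
    qed
    moreover have "transpose (f Y) = f Y"
      using X(1) Y by (simp add: f_def S_def transpose_scaleR transpose_add matrix_transpose_mul)
    ultimately show "f Y \<in> S" by (simp add: S_def)
  qed
  moreover have "\<forall>Y\<in>S. \<forall>Z\<in>S. dist (f Y) (f Z) \<le> r * dist Y Z"
  proof safe
    fix Y Z assume Y: "Y \<in> S" and Z: "Z \<in> S"
    have "f Y - f Z = (1 / 2) *\<^sub>R (Y ** (Y - Z) + (Y - Z) ** Z)"
      by (simp add: f_def matrix_diff_ldistrib matrix_diff_rdistrib scaleR_right_diff_distrib
          scaleR_right_distrib)
    then have "norm (f Y - f Z) \<le> (norm (Y ** (Y - Z)) + norm ((Y - Z) ** Z)) / 2"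
      using norm_triangle_ineq[of "Y ** (Y - Z)" "(Y - Z) ** Z"] by simp
    moreover have "norm (Y ** (Y - Z)) \<le> r * norm (Y - Z)"
      using Y by (intro norm_matrix_mult_left_le) (simp add: S_def)
    \<comment> \<open>The operator bound concerns left factors, so the symmetric right factor
      \<open>Z\<close> is moved to the left by transposition.\<close>
    moreover have "norm (Z ** transpose (Y - Z)) \<le> r * norm (transpose (Y - Z))"
      using Z by (intro norm_matrix_mult_left_le) (simp add: S_def)
    then have "norm ((Y - Z) ** Z) \<le> r * norm (Y - Z)"
      using norm_transpose[of "(Y - Z) ** Z"] Z
      by (simp add: matrix_transpose_mul norm_transpose S_def)
    ultimately show "dist (f Y) (f Z) \<le> r * dist Y Z"
      by (simp add: dist_norm)
  qed
  ultimately have "\<exists>!Y\<in>S. f Y = Y"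
    using r by (intro Banach_fix) auto
  then obtain Y where Y: "Y \<in> S" "f Y = Y" by blast
  let ?B = "mat 1 - Y"
  have "2 *\<^sub>R Y = 2 *\<^sub>R f Y" using Y by simp
  then have "Y + Y = X + Y ** Y" by (simp add: f_def scaleR_2)
  then have "?B ** ?B = mat 1 - X"
    by (simp add: matrix_diff_ldistrib matrix_diff_rdistrib algebra_simps)
  moreover have "x \<bullet> (?B *v x) > 0" if "x \<noteq> 0" for x
  proof -
    have "x \<bullet> (Y *v x) \<le> norm x * norm (Y *v x)" by (rule norm_cauchy_schwarz)
    also have "\<dots> \<le> norm x * (r * norm x)"
      using Y by (intro mult_left_mono) (auto simp: S_def)
    also have "\<dots> < norm x * norm x"
      using that r by simp
    finally show ?thesis
      by (simp add: matrix_vector_mult_diff_rdistrib inner_diff_right dot_square_norm power2_eq_square)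
  qed
  moreover have "transpose ?B = ?B"
    using Y by (simp add: transpose_diff S_def transpose_mat)
  ultimately show ?thesis
    unfolding pos_def_def by blast
qed

lemma pos_def_scaleR: "pos_def A \<Longrightarrow> k > 0 \<Longrightarrow> pos_def (k *\<^sub>R A)"
  by (simp add: pos_def_def transpose_scaleR flip: scaleR_matrix_vector_assoc)

lemma scaleR_matrix_mult [simp]:
  "(k *\<^sub>R A) ** B = k *\<^sub>R (A ** B)" "A ** (k *\<^sub>R B) = k *\<^sub>R (A ** (B :: real^'k^'n))"
  by (simp_all add: matrix_matrix_mult_def vec_eq_iff sum_distrib_left mult_ac)

text \<open>Scaling brings \<open>A\<close> within operator distance less than 1 of the identity,
  where the fixed-point construction applies.\<close>

lemma pos_def_sqrt_exists:
  fixes A :: "real^'n^'n"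
  assumes "pos_def A"
  shows "\<exists>B. pos_def B \<and> B ** B = A"
proof -
  obtain m where m: "m > 0" "\<And>x. m * (norm x)\<^sup>2 \<le> x \<bullet> (A *v x)"
    using pos_def_coercive assms by blast
  define a where "a = norm A"
  have "m \<le> a"
  proof -
    let ?e = "axis undefined 1 :: real^'n"
    have "m \<le> ?e \<bullet> (A *v ?e)" using m(2)[of ?e] by simp
    also have "\<dots> \<le> norm ?e * (norm A * norm ?e)"
      by (rule order_trans[OF norm_cauchy_schwarz mult_left_mono[OF norm_matrix_vector_mult_le]]) simp
    finally show ?thesis by (simp add: a_def)
  qed
  with m have a: "a > 0" by simp
  \<comment> \<open>This \<open>k\<close> minimises \<open>1 - 2 m / k + a^2 / k^2\<close>, the
    bound on the squared operator norm of \<open>X\<close>; the minimum is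
    \<open>1 - (m / a)^2\<close>.\<close>
  define k where "k = a\<^sup>2 / m"
  have k: "k > 0" using a m by (simp add: k_def)
  define X where "X = mat 1 - (1 / k) *\<^sub>R A"
  define q where "q = sqrt (1 - (m / a)\<^sup>2)"
  have ma: "(m / a)\<^sup>2 \<le> 1" "0 < (m / a)\<^sup>2"
    using m a \<open>m \<le> a\<close> by (simp_all add: power_le_one)
  have q: "0 \<le> q" "q < 1" "q\<^sup>2 = 1 - (m / a)\<^sup>2"
    using ma by (simp_all add: q_def)
  have "norm (X *v x) \<le> q * norm x" for x
  proof (rule power2_le_imp_le)
    have "(norm (X *v x))\<^sup>2 = (norm x)\<^sup>2 - 2 * (x \<bullet> (A *v x)) / k + (norm (A *v x))\<^sup>2 / k\<^sup>2"
      unfolding X_def power2_norm_eq_inner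
      by (simp add: matrix_vector_mult_diff_rdistrib inner_diff_left inner_diff_right inner_commute
          power2_eq_square flip: scaleR_matrix_vector_assoc)
    also have "\<dots> \<le> (norm x)\<^sup>2 - 2 * (m * (norm x)\<^sup>2) / k + (a * norm x)\<^sup>2 / k\<^sup>2"
      using k m(2) unfolding a_def
      by (intro add_mono diff_mono divide_right_mono mult_left_mono power_mono
          norm_matrix_vector_mult_le) auto
    also have "\<dots> = (q * norm x)\<^sup>2"
      using m a unfolding power_mult_distrib q(3) k_def by (simp add: field_simps power2_eq_square)
    finally show "(norm (X *v x))\<^sup>2 \<le> (q * norm x)\<^sup>2" .
  qed (use q in simp)
  moreover have "transpose X = X"
    using assms by (simp add: X_def pos_def_def transpose_diff transpose_scaleR transpose_mat)
  ultimately obtain B where B: "pos_def B" "B ** B = mat 1 - X"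
    using symmetric_sqrt_near_identity q by blast
  have "pos_def (sqrt k *\<^sub>R B)" "(sqrt k *\<^sub>R B) ** (sqrt k *\<^sub>R B) = A"
    using B k by (simp_all add: pos_def_scaleR X_def)
  then show ?thesis by blast
qed

lemma pd_sqrt:
  assumes "pos_def A"
  shows "pos_def (pd_sqrt A)" "pd_sqrt A ** pd_sqrt A = A"
proof -
  have "pos_def (pd_sqrt A) \<and> pd_sqrt A ** pd_sqrt A = A"
    unfolding pd_sqrt_def
    by (rule theI') (use assms pos_def_sqrt_exists pos_def_sqrt_unique in metis)
  then show "pos_def (pd_sqrt A)" "pd_sqrt A ** pd_sqrt A = A" by auto
qed

lemma pd_sqrt_eqI: "pos_def B \<Longrightarrow> B ** B = A \<Longrightarrow> pos_def A \<Longrightarrow> pd_sqrt A = B"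
  using pd_sqrt pos_def_sqrt_unique by metis

section \<open>Inverses and determinants of positive definite matrices\<close>

lemma pos_def_matrix_inv_mult:
  assumes "pos_def A"
  shows "A ** matrix_inv A = mat 1" "matrix_inv A ** A = mat 1"
proof -
  have "\<forall>x. A *v x = 0 \<longrightarrow> x = 0"
    using assms unfolding pos_def_def by (metis inner_zero_right less_irrefl)
  then obtain B where B: "B ** A = mat 1"
    using matrix_left_invertible_ker by blast
  then have "matrix_inv A = B"
    by (intro matrix_inv_eqI) (simp add: matrix_left_right_inverse)
  then show "A ** matrix_inv A = mat 1" "matrix_inv A ** A = mat 1"
    using B matrix_left_right_inverse by auto
qed

lemma transpose_matrix_inv_pos_def:
  assumes "pos_def A"
  shows "transpose (matrix_inv A) = matrix_inv A"
proof -
  have "transpose A = A" using assms by (simp add: pos_def_def)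
  then have "A ** transpose (matrix_inv A) = mat 1"
    using arg_cong[OF pos_def_matrix_inv_mult(2)[OF assms], of transpose]
    by (simp add: matrix_transpose_mul transpose_mat)
  then show ?thesis using matrix_inv_eqI by metis
qed

lemma pos_def_matrix_inv:
  assumes "pos_def A"
  shows "pos_def (matrix_inv A)"
  unfolding pos_def_def
proof (intro conjI allI impI)
  fix x :: "real^'a" assume "x \<noteq> 0"
  define y where "y = matrix_inv A *v x"
  have x: "x = A *v y"
    by (simp add: y_def matrix_vector_mul_assoc pos_def_matrix_inv_mult[OF assms])
  with \<open>x \<noteq> 0\<close> have "y \<noteq> 0" by auto
  then have "y \<bullet> (A *v y) > 0" using assms by (simp add: pos_def_def)
  then show "x \<bullet> (matrix_inv A *v x) > 0"
    using x by (metis inner_commute y_def)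
qed (simp add: transpose_matrix_inv_pos_def assms)

text \<open>The determinant is a square because \<open>A\<close> is, and it is nonzero because
  \<open>A\<close> is invertible.\<close>

lemma pos_def_det: "pos_def A \<Longrightarrow> det A > 0"
  using pd_sqrt[of A] pos_def_matrix_inv_mult[of A]
  by (metis det_I det_mul mult_eq_0_iff not_square_less_zero linorder_neqE_linordered_idom zero_neq_one)

subsection \<open>Block matrices and the holonomy\<close>

lemma sum_option_UNIV:
  "(\<Sum>i\<in>UNIV. f i) = f None + (\<Sum>i\<in>UNIV. f (Some (i :: 'd::finite)))"
  by (simp add: UNIV_option_conv sum.reindex)

lemma option_vec_eq_iff:
  "(x :: 'a^('d::finite option)) = y \<longleftrightarrow> x $ None = y $ None \<and> (\<forall>i. x $ Some i = y $ Some i)"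
  by (simp add: vec_eq_iff split_option_all)

lemma block_matrix_nth [simp]:
  "block_matrix a r l B $ None $ None = a"
  "block_matrix a r l B $ None $ Some j = r $ j"
  "block_matrix a r l B $ Some i $ None = l $ i"
  "block_matrix a r l B $ Some i $ Some j = B $ i $ j"
  by (simp_all add: block_matrix_def)

lemma outer_nth [simp]: "outer v $ i $ j = v $ i * v $ j"
  by (simp add: outer_def matrix_matrix_mult_def columnvector_def rowvector_def)

lemma transpose_outer [simp]: "transpose (outer v) = outer v"
  by (simp add: transpose_def vec_eq_iff)

lemma outer_mult_vector: "outer v *v x = (v \<bullet> x) *\<^sub>R v"
  by (simp add: vec_eq_iff matrix_vector_mult_def inner_vec_def sum_distrib_left mult_ac)

lemma vector_matrix_mult_scaleR: "x v* (k *\<^sub>R A) = k *\<^sub>R (x v* (A :: real^'n^'m))"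
  by (simp add: vec_eq_iff vector_matrix_mult_def sum_distrib_left mult_ac)

lemma outer_0 [simp]: "outer 0 = 0"
  by (simp add: vec_eq_iff)

lemma block_matrix_eq_iff [simp]:
  "block_matrix a r l B = block_matrix a' r' l' B' \<longleftrightarrow> a = a' \<and> r = r' \<and> l = l' \<and> B = B'"
  by (auto simp: option_vec_eq_iff vec_eq_iff)

lemma block_matrix_mult:
  "block_matrix a r l B ** block_matrix a' r' l' B' =
     block_matrix (a * a' + r \<bullet> l') (a *\<^sub>R r' + r v* B') (a' *\<^sub>R l + B *v l')
       ((\<chi> i j. l $ i * r' $ j) + B ** B')"
  by (simp add: option_vec_eq_iff matrix_matrix_mult_def sum_option_UNIV inner_vec_def
      vector_matrix_mult_def matrix_vector_mult_def mult_ac)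

lemma block_upper_mult:
  "block_matrix a r 0 B ** block_matrix a' r' 0 B' =
     block_matrix (a * a') (a *\<^sub>R r' + r v* B') 0 (B ** B')"
  by (simp add: block_matrix_mult) (simp add: vec_eq_iff)

lemma transpose_block_matrix: "transpose (block_matrix a r l B) = block_matrix a l r (transpose B)"
  by (simp add: option_vec_eq_iff transpose_def)

lemma scaleR_block_matrix:
  "k *\<^sub>R block_matrix a r l B = block_matrix (k * a) (k *\<^sub>R r) (k *\<^sub>R l) (k *\<^sub>R B)"
  by (simp add: option_vec_eq_iff)

lemma mat_1_block: "mat 1 = block_matrix 1 0 0 (mat 1)"
  by (simp add: option_vec_eq_iff mat_def)

lemma mat_eq_scaleR: "mat k = k *\<^sub>R (mat 1 :: real^'n^'n)"
  by (simp add: vec_eq_iff mat_def)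

lemma block_upper_inverse:
  assumes "p \<noteq> 0" "S ** S' = mat 1"
  shows "block_matrix p r 0 S ** block_matrix (1 / p) (- (1 / p) *\<^sub>R (r v* S')) 0 S' = mat 1"
  using assms by (simp add: block_upper_mult mat_1_block)

section \<open>The canonical map of a single medium\<close>

lemma pos_def_w3_block:
  assumes "c > 0" "pos_def A"
  shows "pos_def (c *\<^sub>R matrix_inv (pd_sqrt A))"
  using assms by (intro pos_def_scaleR pos_def_matrix_inv pd_sqrt)

text \<open>Keeps only what the sign and polar arguments need, the positive time entry and the
  spatial block.\<close>

lemma w3_block:
  assumes "c > 0" "admissible_medium v C"
  obtains p q where "p > 0" "w3 c v C = block_matrix p q 0 (c *\<^sub>R matrix_inv (pd_sqrt (C - outer v)))"
proof -
  have A: "pos_def (matrix_inv (C - outer v))"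
    using assms pos_def_matrix_inv by (auto simp: admissible_medium_def)
  have "v \<bullet> (matrix_inv (C - outer v) *v v) \<ge> 0"
    using A unfolding pos_def_def by (metis inner_zero_left less_eq_real_def)
  then show ?thesis
    by (intro that[of "1 / sqrt (1 + v \<bullet> (matrix_inv (C - outer v) *v v))"])
      (auto simp: w3_def Let_def)
qed

text \<open>The choice \<open>A *v a = v\<close> annihilates the upper right row of
  \<open>w3 c v C ** Q_matrix v C\<close>. The time entry is then normalised by
  \<open>p^2 (1 + v \<bullet> a) = 1\<close>, and the spatial block by
  \<open>N ** A ** N = mat 1\<close>.\<close>

lemma w3_normalises_Q_matrix:
  assumes "c > 0" "admissible_medium v C"
  shows "w3 c v C ** Q_matrix v C ** transpose (w3 c v C) = Q_star c"
proof -
  define A where "A = C - outer v"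
  define a where "a = matrix_inv A *v v"
  define p where "p = 1 / sqrt (1 + v \<bullet> a)"
  define N where "N = matrix_inv (pd_sqrt A)"
  have A: "pos_def A" using assms by (simp add: admissible_medium_def A_def)
  have "v \<bullet> a \<ge> 0"
    using pos_def_matrix_inv[OF A] unfolding a_def pos_def_def
    by (metis inner_zero_left less_eq_real_def)
  then have p: "p * (p * (1 + v \<bullet> a)) = 1"
    by (simp add: p_def)
  have Aa: "A *v a = v"
    by (simp add: a_def matrix_vector_mul_assoc pos_def_matrix_inv_mult A)
  have tA: "transpose A = A" using A by (simp add: pos_def_def)
  have aA: "a v* A = v"
    using Aa tA by (metis transpose_matrix_vector)
  have tN: "transpose N = N"
    by (simp add: N_def transpose_matrix_inv_pos_def pd_sqrt A)
  have "N ** A ** N = (N ** pd_sqrt A) ** (pd_sqrt A ** N)"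
    by (metis A matrix_mul_assoc pd_sqrt(2))
  then have NAN: "N ** A ** N = mat 1"
    by (simp add: N_def pos_def_matrix_inv_mult pd_sqrt A)
  have w: "w3 c v C = block_matrix p (p *\<^sub>R a) 0 (c *\<^sub>R N)"
    by (simp add: w3_def Let_def A_def a_def p_def N_def)
  have Q: "Q_matrix v C = block_matrix 1 v v (- A)"
    by (simp add: Q_matrix_def A_def)
  have neg: "N ** (- A) = - (N ** A)" "(p *\<^sub>R a) v* (- A) = - (p *\<^sub>R v)"
    "(- (N ** A)) ** N = - (N ** A ** N)" for N
    using aA by (simp_all add: vec_eq_iff matrix_matrix_mult_def vector_matrix_mult_def sum_negf
        mult_ac flip: sum_distrib_left)
  have wQ: "w3 c v C ** Q_matrix v C = block_matrix (p * (1 + v \<bullet> a)) 0 (c *\<^sub>R (N *v v)) (- (c *\<^sub>R (N ** A)))"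
    unfolding w Q block_matrix_mult using neg
    by (simp add: algebra_simps inner_commute flip: scaleR_matrix_vector_assoc)
      (simp add: vec_eq_iff)
  \<comment> \<open>The lower left column of the full product: \<open>A *v a = v\<close> makes its
    two contributions cancel.\<close>
  have z: "p *\<^sub>R (c *\<^sub>R (N *v v)) + - (c *\<^sub>R (N ** A)) *v (p *\<^sub>R a) = 0"
  proof -
    have "- (c *\<^sub>R (N ** A)) *v (p *\<^sub>R a) = (- (c * p)) *\<^sub>R ((N ** A) *v a)"
      by (simp add: vec_eq_iff matrix_vector_mult_def sum_negf sum_distrib_left mult_ac)
    also have "(N ** A) *v a = N *v v"
      by (simp add: Aa flip: matrix_vector_mul_assoc)
    finally show ?thesis by (simp add: mult_ac)
  qed
  have "(- (c *\<^sub>R (N ** A))) ** (c *\<^sub>R N) = - ((c * c) *\<^sub>R (N ** A ** N))"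
    by (simp add: neg flip: scaleR_minus_right)
  moreover have "mat (c\<^sup>2) = (c * c) *\<^sub>R (mat 1 :: real^'a^'a)"
    by (subst mat_eq_scaleR) (simp add: power2_eq_square)
  ultimately show ?thesis
    unfolding wQ unfolding w transpose_block_matrix block_matrix_mult Q_star_def
    using p z by (simp add: transpose_scaleR tN NAN mult_ac)
      (simp add: vec_eq_iff)
qed

section \<open>Composites of block triangular maps\<close>

lemma composite_snoc [simp]: "composite (Ws @ [U]) = U ** composite Ws"
  by (simp add: composite_def)

lemma composite_Nil [simp]: "composite [] = mat 1"
  by (simp add: composite_def)

text \<open>The row \<open>r\<close> stays existential, since the argument for the holonomy
  eliminates the time row whatever its value.\<close>

lemma composite_block_upper:
  "\<exists>r. composite (map (\<lambda>x. block_matrix (p x) (q x) 0 (S x)) xs) =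
     block_matrix (\<Prod>x\<leftarrow>xs. p x) r 0 (composite (map S xs))"
proof (induction xs rule: rev_induct)
  case Nil
  show ?case by (auto simp: mat_1_block)
next
  case (snoc x xs)
  then obtain r where "composite (map (\<lambda>x. block_matrix (p x) (q x) 0 (S x)) xs) =
     block_matrix (\<Prod>x\<leftarrow>xs. p x) r 0 (composite (map S xs))" by blast
  then show ?case by (auto simp: block_upper_mult mult.commute)
qed

lemma det_composite_pos: "(\<And>U. U \<in> set Us \<Longrightarrow> det U > 0) \<Longrightarrow> det (composite Us) > 0"
  by (induction Us rule: rev_induct) (auto simp: det_mul)

text \<open>The positive time entry and the positive determinant later decide two signs, that of the
  time entry of the holonomy and that of \<open>det R\<close>.\<close>

lemma composite_w3_block:
  assumes "c > 0" "\<And>u E. (u, E) \<in> set steps \<Longrightarrow> admissible_medium u E"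
  obtains a r where "a > 0"
    "composite (map (\<lambda>(u, E). w3 c u E) steps) = block_matrix a r 0
      (composite (map (\<lambda>(u, E). c *\<^sub>R matrix_inv (pd_sqrt (E - outer u))) steps))"
    "det (composite (map (\<lambda>(u, E). c *\<^sub>R matrix_inv (pd_sqrt (E - outer u))) steps)) > 0"
proof -
  have "\<forall>x\<in>set steps. \<exists>p q. p > 0 \<and>
      w3 c (fst x) (snd x) = block_matrix p q 0 (c *\<^sub>R matrix_inv (pd_sqrt (snd x - outer (fst x))))"
    using assms w3_block by (metis prod.collapse)
  then obtain p q where pq: "\<And>x. x \<in> set steps \<Longrightarrow> p x > 0"
    "\<And>x. x \<in> set steps \<Longrightarrow> w3 c (fst x) (snd x) =
      block_matrix (p x) (q x) 0 (c *\<^sub>R matrix_inv (pd_sqrt (snd x - outer (fst x))))"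
    by metis
  have eq: "map (\<lambda>(u, E). w3 c u E) steps = map (\<lambda>x. block_matrix (p x) (q x) 0
      ((\<lambda>(u, E). c *\<^sub>R matrix_inv (pd_sqrt (E - outer u))) x)) steps"
    using pq(2) by (auto simp: case_prod_unfold)
  obtain r where r: "composite (map (\<lambda>(u, E). w3 c u E) steps) = block_matrix (\<Prod>x\<leftarrow>steps. p x) r 0
      (composite (map (\<lambda>(u, E). c *\<^sub>R matrix_inv (pd_sqrt (E - outer u))) steps))"
    unfolding eq using composite_block_upper by blast
  have "(\<Prod>x\<leftarrow>steps. p x) > 0"
    using pq(1) by (induction steps) auto
  moreover have "det (composite (map (\<lambda>(u, E). c *\<^sub>R matrix_inv (pd_sqrt (E - outer u))) steps)) > 0"
    using assms by (intro det_composite_pos)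
      (auto simp: admissible_medium_def intro!: pos_def_det pos_def_w3_block)
  ultimately show ?thesis
    using that r by blast
qed

section \<open>The holonomy of a loop\<close>

lemma holonomy_times_w3:
  assumes "c > 0" "admissible_medium v C"
  shows "holonomy c W v C ** w3 c v C = W"
proof -
  obtain p q where w: "p > 0" "w3 c v C = block_matrix p q 0 (c *\<^sub>R matrix_inv (pd_sqrt (C - outer v)))"
    using w3_block assms by metis
  have "pos_def (c *\<^sub>R matrix_inv (pd_sqrt (C - outer v)))"
    using assms by (simp add: pos_def_w3_block admissible_medium_def)
  from block_upper_inverse[OF _ pos_def_matrix_inv_mult(1)[OF this], of p q] w
  have "matrix_inv (w3 c v C) ** w3 c v C = mat 1"
    by (metis less_irrefl matrix_inv_eqI matrix_left_right_inverse)
  then show ?thesis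
    by (simp add: holonomy_def flip: matrix_mul_assoc)
qed

text \<open>Comparison of the spatial blocks in \<open>W = holonomy c W v C ** w3 c v C\<close>. For
  \<open>k > 0\<close> and orthogonal \<open>R\<close> it exhibits the polar decomposition of
  \<open>S\<close>.\<close>

lemma holonomy_spatial_block:
  assumes "c > 0" "admissible_medium v C" "W = block_matrix a r 0 S"
    and "holonomy c W v C = k *\<^sub>R block_matrix 1 0 0 R"
  shows "S = R ** ((k * c) *\<^sub>R matrix_inv (pd_sqrt (C - outer v)))"
proof -
  obtain p q where w: "w3 c v C = block_matrix p q 0 (c *\<^sub>R matrix_inv (pd_sqrt (C - outer v)))"
    using w3_block assms by metis
  show ?thesis
    using holonomy_times_w3[OF assms(1,2), of W] unfolding assms(3,4) w
    unfolding assms(4)[unfolded assms(3)]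
    by (auto simp: scaleR_block_matrix block_upper_mult mult.commute)
qed

text \<open>Among the block equations for \<open>D\<close>, the lower left one reads
  \<open>F *v e = 0\<close> and kills the time row because \<open>F\<close> is invertible. The time
  entry then gives \<open>d^2 = k^2\<close>, the spatial block
  \<open>F ** transpose F = k^2\<close>, and the signs of \<open>a\<close> and \<open>det S\<close>
  select \<open>d = k\<close> and \<open>det R = 1\<close>.\<close>

lemma holonomy_rotation:
  assumes c: "c > 0" and W: "W = block_matrix a r 0 S" "a > 0" "det S > 0"
    and e: "endpoint c W v C"
  shows "\<exists>R. rotation_matrix R \<and> holonomy c W v C = rho c W *\<^sub>R block_matrix 1 0 0 R"
proof -
  define w where "w = w3 c v C"
  define X where "X = matrix_inv w"
  define D where "D = holonomy c W v C"
  define k where "k = rho c W"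
  have adm: "admissible_medium v C" and q: "q00 c W > 0"
    and Q: "(1 / q00 c W) *\<^sub>R Q_end c W = Q_matrix v C"
    using e by (auto simp: endpoint_def)
  have k: "k > 0" "k\<^sup>2 = 1 / q00 c W"
    using q by (auto simp: k_def rho_def power_divide)
  obtain p g where w: "p > 0" "w = block_matrix p g 0 (c *\<^sub>R matrix_inv (pd_sqrt (C - outer v)))"
    using w3_block c adm w_def by metis
  define Z where "Z = c *\<^sub>R matrix_inv (pd_sqrt (C - outer v))"
  have Z: "pos_def Z"
    using adm c by (simp add: pos_def_w3_block admissible_medium_def Z_def)
  have X: "X = block_matrix (1 / p) (- (1 / p) *\<^sub>R (g v* matrix_inv Z)) 0 (matrix_inv Z)"
    unfolding X_def w(2) Z_def[symmetric] using w(1)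
    by (intro matrix_inv_eqI block_upper_inverse pos_def_matrix_inv_mult Z) auto
  have wX: "w ** X = mat 1" "X ** w = mat 1"
    unfolding X unfolding w(2) Z_def[symmetric]
    using w(1) block_upper_inverse[OF _ pos_def_matrix_inv_mult(1)[OF Z]]
    by (auto simp: matrix_left_right_inverse)
  obtain d e F where D: "D = block_matrix d e 0 F" and d: "d > 0" and F: "det F > 0"
  proof
    show "D = block_matrix (a * (1 / p)) (a *\<^sub>R (- (1 / p) *\<^sub>R (g v* matrix_inv Z)) + r v* matrix_inv Z) 0
        (S ** matrix_inv Z)"
      by (simp only: D_def holonomy_def w_def[symmetric] X_def[symmetric]) (simp only: X W(1) block_upper_mult)
    show "a * (1 / p) > 0" using W(2) w(1) by simp
    show "det (S ** matrix_inv Z) > 0"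
      using W(3) pos_def_det[OF pos_def_matrix_inv[OF Z]] by (simp add: det_mul)
  qed
  have WW: "W ** matrix_inv W = mat 1"
  proof -
    obtain S' where "S ** S' = mat 1"
      using W(3) by (metis invertible_def invertible_det_nz less_irrefl)
    from block_upper_inverse[OF _ this, of a r] show ?thesis
      using W(1,2) matrix_inv_eqI by (metis less_irrefl)
  qed
  \<comment> \<open>The endpoint map carries \<open>Q_matrix v C\<close> to \<open>Q_star c\<close>,
    so \<open>D\<close> acts on \<open>Q_star c\<close> as \<open>W\<close> acts on
    \<open>Q_matrix v C\<close>, which is \<open>k^2\<close> times \<open>Q_end c W\<close>.\<close>
  have "D ** Q_star c ** transpose D =
      W ** (X ** w) ** Q_matrix v C ** transpose (W ** (X ** w))"
    unfolding D_def holonomy_def w_def[symmetric] X_def[symmetric]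
    by (simp only: w3_normalises_Q_matrix[OF c adm, symmetric] w_def[symmetric] matrix_transpose_mul
        matrix_mul_assoc)
  also have "\<dots> = W ** Q_matrix v C ** transpose W"
    by (simp add: wX)
  also have "\<dots> = k\<^sup>2 *\<^sub>R (W ** Q_end c W ** transpose W)"
    by (simp add: k flip: Q)
  also have "W ** Q_end c W ** transpose W =
      (W ** matrix_inv W) ** Q_star c ** transpose (W ** matrix_inv W)"
    unfolding Q_end_def by (simp only: matrix_transpose_mul matrix_mul_assoc)
  also have "\<dots> = Q_star c"
    by (simp add: WW transpose_mat)
  finally have main: "D ** Q_star c ** transpose D = k\<^sup>2 *\<^sub>R Q_star c" .
  have Qs: "Q_star c = block_matrix 1 0 0 ((- (c\<^sup>2)) *\<^sub>R mat 1)"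
    by (simp add: Q_star_def mat_eq_scaleR[of "c\<^sup>2"])
  have "D ** Q_star c = block_matrix d ((- (c\<^sup>2)) *\<^sub>R e) 0 ((- (c\<^sup>2)) *\<^sub>R F)"
    unfolding D Qs block_upper_mult vector_matrix_mult_scaleR scaleR_matrix_mult by simp
  then have "block_matrix (d * d + ((- (c\<^sup>2)) *\<^sub>R e) \<bullet> e) (((- (c\<^sup>2)) *\<^sub>R e) v* transpose F)
      (((- (c\<^sup>2)) *\<^sub>R F) *v e) (((- (c\<^sup>2)) *\<^sub>R F) ** transpose F) =
      block_matrix (k\<^sup>2) 0 0 (k\<^sup>2 *\<^sub>R ((- (c\<^sup>2)) *\<^sub>R mat 1))"
    using main unfolding D transpose_block_matrix Qs
    by (simp add: block_matrix_mult scaleR_block_matrix) (simp add: vec_eq_iff)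
  then have eqs: "d * d + ((- (c\<^sup>2)) *\<^sub>R e) \<bullet> e = k\<^sup>2" "((- (c\<^sup>2)) *\<^sub>R F) *v e = 0"
    "((- (c\<^sup>2)) *\<^sub>R F) ** transpose F = k\<^sup>2 *\<^sub>R ((- (c\<^sup>2)) *\<^sub>R mat 1)"
    by simp_all
  obtain F' where F': "F' ** F = mat 1"
    using F by (metis invertible_def invertible_det_nz less_irrefl)
  have "(- (c\<^sup>2)) *\<^sub>R (F *v e) = 0"
    using eqs(2) by (simp only: scaleR_matrix_vector_assoc)
  then have "F *v e = 0" using c by simp
  then have e0: "e = 0"
    using F' by (metis matrix_vector_mul_assoc matrix_vector_mul_lid matrix_vector_mult_0_right)
  then have dk: "d = k"
    using eqs(1) d k(1) by (simp add: power2_eq_square[symmetric])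
  define R where "R = (1 / k) *\<^sub>R F"
  have FF: "F ** transpose F = k\<^sup>2 *\<^sub>R mat 1"
  proof -
    have "(- (c\<^sup>2)) *\<^sub>R (F ** transpose F) = (- (c\<^sup>2)) *\<^sub>R (k\<^sup>2 *\<^sub>R mat 1)"
      using eqs(3) by (simp only: scaleR_matrix_mult scaleR_scaleR mult.commute)
    then show ?thesis using c by (simp only: scaleR_cancel_left) simp
  qed
  have "R ** transpose R = mat 1"
    using k(1) by (simp add: R_def transpose_scaleR FF power2_eq_square)
  then have orth: "orthogonal_matrix R"
    by (simp add: orthogonal_matrix_def matrix_left_right_inverse)
  have "F = (k *\<^sub>R mat 1) ** R"
    using k(1) by (simp add: R_def)
  moreover have "pos_def (k *\<^sub>R mat 1 :: real^'a^'a)"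
    using k(1) by (intro pos_def_scaleR) (simp_all add: pos_def_def transpose_mat)
  then have "det (k *\<^sub>R mat 1 :: real^'a^'a) > 0" by (rule pos_def_det)
  ultimately have "det R > 0"
    using F by (simp only: det_mul zero_less_mult_iff) auto
  then have "rotation_matrix R"
    using orth det_orthogonal_matrix[OF orth] by (auto simp: rotation_matrix_def)
  moreover have "D = k *\<^sub>R block_matrix 1 0 0 R"
    using k(1) by (simp add: D e0 dk R_def scaleR_block_matrix)
  ultimately show ?thesis
    unfolding D_def k_def by blast
qed

subsection \<open>Orthogonal substitutions and directivities\<close>

lemma nn_integral_lborel_shift:
  fixes f :: "'a::euclidean_space \<Rightarrow> ennreal"
  assumes [measurable]: "f \<in> borel_measurable borel"
  shows "(\<integral>\<^sup>+x. f (a + x) \<partial>lborel) = (\<integral>\<^sup>+x. f x \<partial>lborel)"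
proof -
  have "(\<integral>\<^sup>+x. f x \<partial>distr lborel borel ((+) a)) = (\<integral>\<^sup>+x. f (a + x) \<partial>lborel)"
    by (intro nn_integral_distr) auto
  then show ?thesis by (simp add: lborel_distr_plus)
qed

text \<open>
  The library has the change of variables only for well-ordered index types, and \<open>'d option\<close> is
  not one. Here translation invariance and Fubini compare the image measure with \<open>lborel\<close>, as in
  the proof of the uniqueness of Haar measure; the unit ball fixes the constant.
\<close>

lemma lborel_distr_orthogonal_transformation:
  fixes f :: "'a::euclidean_space \<Rightarrow> 'a"
  assumes f: "orthogonal_transformation f"
  shows "distr lborel borel f = lborel"
proof (rule measure_eqI)
  obtain g where g: "linear g" "\<And>x. f (g x) = x"
    using orthogonal_transformation_surj[OF f] linear_surjective_right_inverse
      orthogonal_transformation_linear[OF f] by (metis comp_apply id_apply)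
  have fl: "linear f" using f by (rule orthogonal_transformation_linear)
  have [measurable]: "f \<in> borel_measurable borel" "g \<in> borel_measurable borel"
    using fl g by (auto intro!: borel_measurable_continuous_onI linear_continuous_on
        simp: linear_linear)
  fix B assume "B \<in> sets (distr lborel borel f)"
  then have [measurable]: "B \<in> sets borel" by simp
  let ?A = "ball (0::'a) 1"
  let ?a = "indicator ?A :: 'a \<Rightarrow> ennreal" and ?b = "indicator B :: 'a \<Rightarrow> ennreal"
  have [measurable]: "?a \<in> borel_measurable borel"
    by (simp add: borel_measurable_indicator)
  have fA: "f -` ?A = ?A"
    using orthogonal_transformation_norm[OF f] by (auto simp: dist_norm)
  have fA': "?a (f x) = ?a x" for x
    using fA by (auto simp: indicator_def)
  \<comment> \<open>Shifting \<open>y\<close> by \<open>f x\<close> and then \<open>x\<close> by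
    \<open>- g y\<close> turns the pair \<open>f x, y\<close> into \<open>f x - y, f x\<close>. The
    integral over \<open>y\<close> then yields the measure of the ball, and the one over
    \<open>x\<close> the image measure of \<open>B\<close>.\<close>
  have "emeasure lborel ?A * emeasure lborel B = (\<integral>\<^sup>+x. (\<integral>\<^sup>+y. ?a (f x) * ?b y \<partial>lborel) \<partial>lborel)"
    by (simp add: fA' nn_integral_cmult) (subst nn_integral_multc; simp)
  also have "\<dots> = (\<integral>\<^sup>+x. (\<integral>\<^sup>+y. ?a (f x) * ?b (f x + y) \<partial>lborel) \<partial>lborel)"
    by (intro nn_integral_cong nn_integral_lborel_shift[symmetric]) simp
  also have "\<dots> = (\<integral>\<^sup>+y. (\<integral>\<^sup>+x. ?a (f x) * ?b (f x + y) \<partial>lborel) \<partial>lborel)"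
    by (rule lborel_pair.Fubini') simp
  also have "\<dots> = (\<integral>\<^sup>+y. (\<integral>\<^sup>+x. ?a (f (- g y + x)) * ?b (f (- g y + x) + y) \<partial>lborel) \<partial>lborel)"
    by (intro nn_integral_cong nn_integral_lborel_shift[symmetric]) simp
  also have "\<dots> = (\<integral>\<^sup>+y. (\<integral>\<^sup>+x. ?a (f x - y) * ?b (f x) \<partial>lborel) \<partial>lborel)"
    by (simp add: linear_add[OF fl] linear_neg[OF fl] linear_diff[OF fl] g)
  also have "\<dots> = (\<integral>\<^sup>+x. (\<integral>\<^sup>+y. ?a (f x - y) * ?b (f x) \<partial>lborel) \<partial>lborel)"
    by (rule lborel_pair.Fubini') simp
  also have "\<dots> = (\<integral>\<^sup>+x. emeasure lborel ?A * ?b (f x) \<partial>lborel)"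
  proof (rule nn_integral_cong)
    fix x
    \<comment> \<open>The central symmetry of the ball stands in for a reflection of
      \<open>y\<close>.\<close>
    have "?a (f x - y) = ?a (- f x + y)" for y
      by (simp add: indicator_def norm_minus_commute)
    then have "(\<integral>\<^sup>+y. ?a (f x - y) \<partial>lborel) = (\<integral>\<^sup>+y. ?a (- f x + y) \<partial>lborel)"
      by presburger
    also have "\<dots> = emeasure lborel ?A"
      by (subst nn_integral_lborel_shift) auto
    finally show "(\<integral>\<^sup>+y. ?a (f x - y) * ?b (f x) \<partial>lborel) = emeasure lborel ?A * ?b (f x)"
      by (simp add: nn_integral_multc)
  qed
  also have "\<dots> = emeasure lborel ?A * emeasure (distr lborel borel f) B"
  proof -
    have "(\<integral>\<^sup>+x. ?b x \<partial>distr lborel borel f) = (\<integral>\<^sup>+x. ?b (f x) \<partial>lborel)"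
      by (intro nn_integral_distr) auto
    then have "(\<integral>\<^sup>+x. ?b (f x) \<partial>lborel) = emeasure (distr lborel borel f) B"
      by simp
    then show ?thesis by (simp add: nn_integral_cmult)
  qed
  finally have "emeasure lborel ?A * emeasure lborel B = emeasure lborel ?A * emeasure (distr lborel borel f) B" .
  moreover have "emeasure lborel ?A < \<infinity>"
    by (rule emeasure_lborel_ball_finite)
  moreover have "emeasure lborel ?A \<noteq> 0"
    using content_ball_pos[of 1 "0::'a"] by (auto simp: measure_def)
  ultimately show "emeasure (distr lborel borel f) B = emeasure lborel B"
    by (auto simp: ennreal_mult_cancel_left)
qed simp

text \<open>The holonomy is a dilation times an orthogonal map, so this is the substitution it calls
  for; the Jacobian comes from the dilation alone.\<close>

lemma lborel_integral_dilated_orthogonal: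
  fixes f :: "'a::euclidean_space \<Rightarrow> 'a" and G :: "'a \<Rightarrow> 'b::{banach, second_countable_topology}"
  assumes f: "orthogonal_transformation f" and r: "r > 0" and [measurable]: "G \<in> borel_measurable borel"
  shows "(\<integral>x. G x \<partial>lborel) = r ^ DIM('a) *\<^sub>R (\<integral>x. G (r *\<^sub>R f x) \<partial>lborel)"
proof -
  have [measurable]: "f \<in> borel_measurable borel"
    using orthogonal_transformation_linear[OF f]
    by (auto intro!: borel_measurable_continuous_onI linear_continuous_on simp: linear_linear)
  have "(\<integral>x. G x \<partial>lborel) =
      (\<integral>x. G x \<partial>density (distr lborel borel (\<lambda>x. 0 + r *\<^sub>R x)) (\<lambda>_. ennreal (\<bar>r\<bar> ^ DIM('a))))"
    using lborel_affine[of r "0::'a"] r by simp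
  also have "\<dots> = (\<integral>x. (r ^ DIM('a)) *\<^sub>R G (r *\<^sub>R x) \<partial>lborel)"
    using r by (subst integral_density) (auto simp: integral_distr)
  also have "\<dots> = r ^ DIM('a) *\<^sub>R (\<integral>x. G (r *\<^sub>R x) \<partial>lborel)"
    by simp
  also have "(\<integral>x. G (r *\<^sub>R x) \<partial>lborel) = (\<integral>x. G (r *\<^sub>R x) \<partial>distr lborel borel f)"
    by (simp add: lborel_distr_orthogonal_transformation f)
  also have "\<dots> = (\<integral>x. G (r *\<^sub>R f x) \<partial>lborel)"
    by (subst integral_distr) auto
  finally show ?thesis .
qed

section \<open>Action of the holonomy on autocorrelations and spectra\<close>

lemma block_matrix_mult_vector:
  "block_matrix a r l B *v x =
     (\<chi> i. case i of None \<Rightarrow> a * x $ None + r \<bullet> (\<chi> j. x $ Some j)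
       | Some i' \<Rightarrow> l $ i' * x $ None + (B *v (\<chi> j. x $ Some j)) $ i')"
  by (simp add: option_vec_eq_iff matrix_vector_mult_def sum_option_UNIV inner_vec_def)

lemma orthogonal_block_matrix:
  assumes "orthogonal_matrix R"
  shows "orthogonal_matrix (block_matrix 1 0 0 R)"
  using assms unfolding orthogonal_matrix_def transpose_block_matrix
  by (simp add: block_upper_mult mat_1_block)

lemma autocorrelation_transport:
  "autocorrelation M (transport r D s) h = (1 / r\<^sup>2)\<^sup>2 * autocorrelation M s (matrix_inv D *v h)"
proof -
  have "(\<lambda>x. transport r D s h x * transport r D s 0 x) =
      (\<lambda>x. (1 / r\<^sup>2)\<^sup>2 * (s (matrix_inv D *v h) x * s 0 x))"
    by (simp add: transport_def fun_eq_iff power2_eq_square)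
  then show ?thesis
    by (simp only: autocorrelation_def integral_mult_right_zero)
qed

text \<open>
  For \<open>d = 3\<close> the Jacobian \<open>\<bar>det D\<bar> = r\<^sup>4\<close> cancels the square of the amplitude factor \<open>r\<^sup>-\<^sup>2\<close>.
\<close>

lemma directivity_transport:
  fixes R :: "real^'d^'d"
  assumes card: "CARD('d) = 3" and R: "rotation_matrix R" and r: "r > 0"
    and D: "D = r *\<^sub>R block_matrix 1 0 0 R" and s: "stationary_source M s"
  shows "directivity K c M (transport r D s) n \<omega> = directivity K c M s (transpose R *v n) (r * \<omega>)"
proof -
  define O' where "O' = block_matrix 1 0 0 R"
  define A where "A = autocorrelation M s"
  define k where "k = (\<omega> / c) *\<^sub>R n"
  define ph where "ph = (\<lambda>h :: real^('d option). \<omega> * h $ None - k \<bullet> (\<chi> i. h $ Some i))"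
  define G where "G h = complex_of_real ((1 / r\<^sup>2)\<^sup>2 * A (matrix_inv D *v h)) * cis (ph h)" for h
  have orth: "orthogonal_matrix O'"
    using R unfolding O'_def by (intro orthogonal_block_matrix) (simp add: rotation_matrix_def)
  have "D ** ((1 / r) *\<^sub>R transpose O') = mat 1"
    using r orth by (simp add: D O'_def[symmetric] orthogonal_matrix_def)
  then have D': "matrix_inv D = (1 / r) *\<^sub>R transpose O'"
    by (rule matrix_inv_eqI)
  have inv: "matrix_inv D *v (r *\<^sub>R (O' *v h)) = h" for h
    using r orth by (simp add: D' matrix_vector_mult_scaleR matrix_vector_mul_assoc orthogonal_matrix_def
        flip: scaleR_matrix_vector_assoc)
  have "A \<in> borel_measurable lborel"
    using s by (auto simp: A_def stationary_source_def)
  then have [measurable]: "A \<in> borel_measurable borel" by simp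
  have [measurable]: "(\<lambda>h. matrix_inv D *v h) \<in> borel_measurable borel"
    by (intro borel_measurable_continuous_onI linear_continuous_on) (simp add: linear_linear)
  have [measurable]: "(\<lambda>h. cis (ph h)) \<in> borel_measurable borel"
    unfolding ph_def by (intro borel_measurable_continuous_onI continuous_intros)
  have [measurable]: "G \<in> borel_measurable borel"
    unfolding G_def by measurable
  \<comment> \<open>The dual action multiplies the frequency by \<open>r\<close> and sends
    \<open>k\<close> to \<open>r\<close> times \<open>transpose R *v k\<close>. The relation
    \<open>k = (\<omega> / c) n\<close> survives with \<open>n\<close> rotated, so the outcome is
    again a directivity.\<close>
  have ph: "ph (r *\<^sub>R (O' *v h)) = (r * \<omega>) * h $ None - ((r * \<omega> / c) *\<^sub>R (transpose R *v n)) \<bullet> (\<chi> i. h $ Some i)" for h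
  proof -
    let ?x = "\<chi> i. h $ Some i"
    have "(\<chi> i. (r *\<^sub>R (O' *v h)) $ Some i) = r *\<^sub>R (R *v ?x)"
      by (simp add: O'_def block_matrix_mult_vector vec_eq_iff)
    then have "ph (r *\<^sub>R (O' *v h)) = (r * \<omega>) * h $ None - (r * \<omega> / c) * (n \<bullet> (R *v ?x))"
      by (simp add: ph_def k_def O'_def block_matrix_mult_vector)
    also have "n \<bullet> (R *v ?x) = (transpose R *v n) \<bullet> ?x"
      by (simp add: dot_lmul_matrix)
    finally show ?thesis by simp
  qed
  have "r ^ 4 * (1 / r\<^sup>2)\<^sup>2 = 1"
    using r by (simp add: power_divide flip: power_mult)
  then have amp: "r ^ 4 *\<^sub>R (complex_of_real ((1 / r\<^sup>2)\<^sup>2 * a) * z) = complex_of_real a * z" for a z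
    by (simp only: scaleR_conv_of_real mult.assoc[symmetric] of_real_mult[symmetric] mult_1_left)
  \<comment> \<open>The exponent is the dimension of space-time, 3 + 1.\<close>
  have "(\<integral>h. G h \<partial>lborel) = r ^ 4 *\<^sub>R (\<integral>h. G (r *\<^sub>R (O' *v h)) \<partial>lborel)"
    using lborel_integral_dilated_orthogonal[of "(*v) O'" r G] r orth card
    by (simp add: orthogonal_transformation_matrix card_UNIV_option)
  also have "\<dots> = (\<integral>h. r ^ 4 *\<^sub>R G (r *\<^sub>R (O' *v h)) \<partial>lborel)"
    by simp
  also have "(\<lambda>h. r ^ 4 *\<^sub>R G (r *\<^sub>R (O' *v h))) = (\<lambda>h. complex_of_real (A h) *
      cis ((r * \<omega>) * h $ None - ((r * \<omega> / c) *\<^sub>R (transpose R *v n)) \<bullet> (\<chi> i. h $ Some i)))"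
    by (simp only: G_def inv ph amp)
  finally show ?thesis
    unfolding directivity_def spectrum_def autocorrelation_transport
    unfolding A_def[symmetric] k_def[symmetric] by (simp add: G_def ph_def)
qed

subsection \<open>Boosts\<close>

text \<open>The form is multiplied by \<open>1 + a * (b \<bullet> b)\<close> in the direction of
  \<open>b\<close>. For negative \<open>a\<close> this is the worst direction, by
  Cauchy-Schwarz.\<close>

lemma pos_def_rank_one_perturbation:
  assumes "a * (b \<bullet> b) > -1"
  shows "pos_def (mat 1 + a *\<^sub>R outer b)"
  unfolding pos_def_def
proof (intro conjI allI impI)
  fix x :: "real^'a" assume x: "x \<noteq> 0"
  have eq: "x \<bullet> ((mat 1 + a *\<^sub>R outer b) *v x) = x \<bullet> x + a * (b \<bullet> x)\<^sup>2"
    by (simp add: matrix_vector_mult_add_rdistrib outer_mult_vector inner_add_right inner_commute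
        power2_eq_square flip: scaleR_matrix_vector_assoc)
  show "x \<bullet> ((mat 1 + a *\<^sub>R outer b) *v x) > 0"
  proof (cases "a \<ge> 0")
    case True
    then show ?thesis using x unfolding eq by (simp add: add_pos_nonneg)
  next
    case False
    have "a * ((b \<bullet> b) * (x \<bullet> x)) \<le> a * (b \<bullet> x)\<^sup>2"
      using False by (intro mult_left_mono_neg Cauchy_Schwarz_ineq) simp
    moreover have "(1 + a * (b \<bullet> b)) * (x \<bullet> x) > 0"
      using assms x by (intro mult_pos_pos) auto
    ultimately show ?thesis unfolding eq by (simp add: algebra_simps)
  qed
qed (simp add: transpose_add transpose_scaleR transpose_mat)

lemma outer_mult_outer: "outer b ** outer b = (b \<bullet> b) *\<^sub>R outer b"
  by (simp add: vec_eq_iff matrix_matrix_mult_def inner_vec_def sum_distrib_left mult_ac)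

text \<open>For fixed \<open>b\<close> these matrices are closed under products, so square roots and
  inverses reduce to scalar equations for the coefficient.\<close>

lemma rank_one_perturbation_mult:
  "(mat 1 + x *\<^sub>R outer b) ** (mat 1 + y *\<^sub>R outer b) =
     mat 1 + (x + y + x * y * (b \<bullet> b)) *\<^sub>R outer b"
  by (simp add: matrix_add_ldistrib matrix_add_rdistrib outer_mult_outer algebra_simps)

lemma outer_scaleR: "outer (k *\<^sub>R b) = k\<^sup>2 *\<^sub>R outer b"
  by (simp add: vec_eq_iff power2_eq_square)

lemma norm_outer: "norm (outer b) = (norm b)\<^sup>2"
proof -
  have "outer b \<bullet> outer b = (b \<bullet> b)\<^sup>2"
    by (simp add: inner_vec_def power2_eq_square sum_product mult_ac)
  then show ?thesis
    by (simp add: norm_eq_sqrt_inner)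
qed

text \<open>For \<open>norm b < 1\<close> this is \<open>(1 - b b^T)^(-1/2)\<close>, with eigenvalue
  \<open>1 / g\<close> along \<open>b\<close> and 1 across it. The coefficient is
  \<open>(1 / g - 1) / (b \<bullet> b)\<close>, rewritten with
  \<open>b \<bullet> b = 1 - g^2\<close> so that it makes sense at \<open>b = 0\<close>.\<close>

definition boost_block :: "real^'d \<Rightarrow> real^'d^'d" where
  "boost_block b = (let g = sqrt (1 - b \<bullet> b) in mat 1 + (1 / (g * (1 + g))) *\<^sub>R outer b)"

lemma boost_medium:
  assumes "c > 0"
  shows "mat (c\<^sup>2) - outer u = c\<^sup>2 *\<^sub>R (mat 1 + (- 1) *\<^sub>R outer ((1 / c) *\<^sub>R u))"
  using assms by (simp add: mat_eq_scaleR[of "c\<^sup>2"] outer_scaleR scaleR_right_diff_distrib power_divide)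

lemma inner_self_less_1:
  assumes "c > 0" "norm u < c"
  shows "((1 / c) *\<^sub>R u) \<bullet> ((1 / c) *\<^sub>R u) < 1"
proof -
  have "norm ((1 / c) *\<^sub>R u) < 1" using assms by simp
  then have "(norm ((1 / c) *\<^sub>R u))\<^sup>2 < 1\<^sup>2" by (intro power_strict_mono) auto
  then show ?thesis by (simp only: power2_norm_eq_inner power_one)
qed

lemma pos_def_boost_medium:
  assumes "c > 0" "norm u < c"
  shows "pos_def (mat (c\<^sup>2) - outer u)"
  unfolding boost_medium[OF assms(1)]
  using assms(1) inner_self_less_1[OF assms]
  by (intro pos_def_scaleR pos_def_rank_one_perturbation) auto

lemma admissible_boost:
  assumes "c > 0" "norm u < c"
  shows "admissible_medium u (mat (c\<^sup>2))"
  using assms by (simp add: admissible_medium_def pos_def_boost_medium transpose_mat)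

lemma boost_spatial_block:
  assumes c: "c > 0" and u: "norm u < c"
  shows "c *\<^sub>R matrix_inv (pd_sqrt (mat (c\<^sup>2) - outer u)) = boost_block ((1 / c) *\<^sub>R u)"
proof -
  define b where "b = (1 / c) *\<^sub>R u"
  define g where "g = sqrt (1 - b \<bullet> b)"
  have bb: "b \<bullet> b < 1" using inner_self_less_1[OF assms] by (simp add: b_def)
  then have g: "g > 0" by (simp add: g_def)
  have bg: "b \<bullet> b = 1 - g\<^sup>2" using bb by (simp add: g_def)
  \<comment> \<open>The square root of \<open>1 - b b^T\<close>: its eigenvalue along
    \<open>b\<close> is \<open>g\<close>.\<close>
  define P where "P = mat 1 + (- 1 / (1 + g)) *\<^sub>R outer b"
  have "(- 1 / (1 + g)) * (b \<bullet> b) = g - 1"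
    using g unfolding bg by (simp add: field_simps power2_eq_square)
  then have P: "pos_def P"
    using g unfolding P_def by (intro pos_def_rank_one_perturbation) simp
  have "- 1 / (1 + g) + - 1 / (1 + g) + - 1 / (1 + g) * (- 1 / (1 + g)) * (b \<bullet> b) = - 1"
    using g unfolding bg by (simp add: divide_simps) (simp add: algebra_simps power2_eq_square)
  then have PP: "P ** P = mat 1 + (- 1) *\<^sub>R outer b"
    unfolding P_def rank_one_perturbation_mult by simp
  have "pd_sqrt (mat (c\<^sup>2) - outer u) = c *\<^sub>R P"
  proof (rule pd_sqrt_eqI)
    show "(c *\<^sub>R P) ** (c *\<^sub>R P) = mat (c\<^sup>2) - outer u"
      unfolding boost_medium[OF c] b_def[symmetric] by (simp add: PP power2_eq_square)
  qed (use c P pos_def_boost_medium[OF assms] pos_def_scaleR in auto)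
  moreover have "matrix_inv (c *\<^sub>R P) = (1 / c) *\<^sub>R boost_block b"
  proof (rule matrix_inv_eqI)
    have "- 1 / (1 + g) + 1 / (g * (1 + g)) + - 1 / (1 + g) * (1 / (g * (1 + g))) * (b \<bullet> b) = 0"
      using g unfolding bg by (simp add: divide_simps) (simp add: algebra_simps power2_eq_square)
    then have "P ** boost_block b = mat 1"
      unfolding P_def boost_block_def g_def[symmetric] Let_def rank_one_perturbation_mult by simp
    then show "(c *\<^sub>R P) ** ((1 / c) *\<^sub>R boost_block b) = mat 1"
      using c by simp
  qed
  ultimately show ?thesis
    using c by (simp add: b_def)
qed

text \<open>The coefficient of \<open>outer b\<close> equals \<open>1 / 2\<close> at
  \<open>g = 1\<close>. Its deviation carries the factor \<open>1 - g\<close>, at most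
  \<open>t\<close>, and a quotient bounded by 2 since \<open>M \<le> 1 / 2\<close> keeps
  \<open>g\<close> above \<open>1 / 2\<close>; the norm of \<open>outer b\<close> supplies the
  second factor \<open>t\<close>.\<close>

lemma boost_block_expansion:
  assumes "norm b \<le> M" "M \<le> 1 / 2"
  shows "norm (boost_block b - (mat 1 + (1 / 2) *\<^sub>R outer b)) \<le> 2 * M ^ 4"
proof -
  define t where "t = (norm b)\<^sup>2"
  define g where "g = sqrt (1 - b \<bullet> b)"
  have M: "M \<ge> 0" using assms norm_ge_zero order_trans by blast
  have tM: "t \<le> M\<^sup>2" unfolding t_def using assms by (intro power_mono) auto
  also have "M\<^sup>2 \<le> (1 / 2)\<^sup>2" using assms M by (intro power_mono)
  finally have t: "0 \<le> t" "t \<le> 1 / 4" by (simp_all add: t_def power2_eq_square)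
  have gt: "g = sqrt (1 - t)" by (simp add: g_def t_def power2_norm_eq_inner)
  have g2: "g\<^sup>2 = 1 - t" using t by (simp add: gt)
  have "sqrt ((1 / 2)\<^sup>2) \<le> g" unfolding gt using t by (intro real_sqrt_le_mono) (simp add: power2_eq_square)
  then have g: "1 / 2 \<le> g" by simp
  have g1: "g \<le> 1" using t by (simp add: gt)
  have "(1 - g) * (1 + g) = t"
    using g2 by (simp add: algebra_simps power2_eq_square)
  moreover have "(1 - g) * 1 \<le> (1 - g) * (1 + g)"
    using g g1 by (intro mult_left_mono) auto
  ultimately have gt': "1 - g \<le> t" by simp
  have eq: "1 / (g * (1 + g)) - 1 / 2 = (1 - g) * ((2 + g) / (2 * g * (1 + g)))"
    using g by (simp add: divide_simps) (simp add: algebra_simps)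
  have den: "2 * g * (1 + g) \<ge> 3 / 2"
  proof -
    have "1 * (3 / 2) \<le> (2 * g) * (1 + g)" using g by (intro mult_mono) auto
    then show ?thesis by simp
  qed
  have "(2 + g) / (2 * g * (1 + g)) \<le> 3 / (3 / 2)"
    using den g g1 by (intro frac_le) auto
  then have "(1 - g) * ((2 + g) / (2 * g * (1 + g))) \<le> t * 2"
    using gt' g g1 t by (intro mult_mono) auto
  moreover have "(1 - g) * ((2 + g) / (2 * g * (1 + g))) \<ge> 0"
    using g g1 by simp
  ultimately have sc: "\<bar>1 / (g * (1 + g)) - 1 / 2\<bar> \<le> 2 * t"
    unfolding eq by linarith
  have "boost_block b - (mat 1 + (1 / 2) *\<^sub>R outer b) = (1 / (g * (1 + g)) - 1 / 2) *\<^sub>R outer b"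
    by (simp add: boost_block_def g_def[symmetric] Let_def scaleR_left_diff_distrib)
  then have "norm (boost_block b - (mat 1 + (1 / 2) *\<^sub>R outer b)) \<le> 2 * t * t"
    using sc t by (simp add: norm_outer t_def[symmetric] mult_right_mono)
  also have "\<dots> \<le> 2 * M\<^sup>2 * M\<^sup>2"
    using tM t by (intro mult_mono) auto
  finally show ?thesis by (simp add: power2_eq_square power4_eq_xxxx mult_ac)
qed

text \<open>The second-order part of a product of boost blocks. As a plain sum it is symmetric and
  at least the identity, which is what the polar comparison asks of \<open>T\<close>.\<close>

definition boost_symbol :: "(real^'d) list \<Rightarrow> real^'d^'d" where
  "boost_symbol bs = mat 1 + (1 / 2) *\<^sub>R (\<Sum>b\<leftarrow>bs. outer b)"

lemma transpose_boost_symbol: "transpose (boost_symbol bs) = boost_symbol bs"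
proof -
  have "transpose (\<Sum>b\<leftarrow>bs. outer b) = (\<Sum>b\<leftarrow>bs. outer b)"
    by (induction bs) (simp_all add: transpose_add, simp add: transpose_def vec_eq_iff)
  then show ?thesis by (simp add: boost_symbol_def transpose_add transpose_scaleR transpose_mat)
qed

lemma boost_symbol_ge_1: "1 * (norm x)\<^sup>2 \<le> x \<bullet> (boost_symbol bs *v x)"
proof -
  have "0 \<le> x \<bullet> ((\<Sum>b\<leftarrow>bs. outer b) *v x)"
    by (induction bs) (simp_all add: matrix_vector_mult_add_rdistrib outer_mult_vector inner_add_right
        inner_commute)
  then show ?thesis
    by (simp add: boost_symbol_def matrix_vector_mult_add_rdistrib inner_add_right power2_norm_eq_inner
        flip: scaleR_matrix_vector_assoc)
qed

lemma norm_boost_symbol: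
  assumes "\<And>b. b \<in> set bs \<Longrightarrow> norm b \<le> M"
  shows "norm (boost_symbol bs - mat 1) \<le> length bs / 2 * M\<^sup>2"
proof -
  have "norm (\<Sum>b\<leftarrow>bs. outer b) \<le> length bs * M\<^sup>2"
    using assms
  proof (induction bs)
    case (Cons b bs)
    have "norm (outer b) \<le> M\<^sup>2"
      using Cons.prems by (auto simp: norm_outer intro!: power_mono)
    moreover have "norm (\<Sum>b\<leftarrow>bs. outer b) \<le> length bs * M\<^sup>2"
      using Cons by simp
    ultimately show ?case
      using norm_triangle_ineq[of "outer b" "\<Sum>b\<leftarrow>bs. outer b"] by (simp add: algebra_simps)
  qed simp
  then show ?thesis by (simp add: boost_symbol_def)
qed

text \<open>Induction on the number of boosts, splitting off the one applied last. \<open>C\<close>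
  is chosen before the list, so it depends on the length and the dimension only.\<close>

lemma boost_product_expansion:
  "\<exists>C\<ge>0. \<forall>(bs :: (real^'d) list) M. length bs = m \<and> (\<forall>b\<in>set bs. norm b \<le> M) \<and> 0 \<le> M \<and> M \<le> 1 / 2 \<longrightarrow>
     norm (composite (map boost_block bs) - boost_symbol bs) \<le> C * M ^ 4"
proof (induction m)
  case 0
  show ?case by (intro exI[of _ 0]) (auto simp: boost_symbol_def)
next
  case (Suc m)
  then obtain C where C: "C \<ge> 0" "\<And>(bs :: (real^'d) list) M. length bs = m \<Longrightarrow>
      (\<And>b. b \<in> set bs \<Longrightarrow> norm b \<le> M) \<Longrightarrow> 0 \<le> M \<Longrightarrow> M \<le> 1 / 2 \<Longrightarrow>
      norm (composite (map boost_block bs) - boost_symbol bs) \<le> C * M ^ 4" by metis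
  define N where "N = norm (mat 1 :: real^'d^'d)"
  have N: "N \<ge> 0" by (simp add: N_def)
  \<comment> \<open>The four summands of the error below contribute \<open>m / 4\<close>,
    \<open>C\<close>, \<open>C\<close> and \<open>2 * (N + m)\<close>. The Frobenius norm
    \<open>N\<close> of the identity is not 1 in general.\<close>
  define C' where "C' = m / 4 + 2 * C + 2 * (N + m)"
  have "norm (composite (map boost_block cs) - boost_symbol cs) \<le> C' * M ^ 4"
    if cs: "length cs = Suc m" "\<forall>b\<in>set cs. norm b \<le> M" and M: "0 \<le> M" "M \<le> 1 / 2"
    for cs :: "(real^'d) list" and M
  proof -
    obtain bs b where bs: "cs = bs @ [b]" "length bs = m"
      using cs(1) by (metis length_Suc_conv_rev)
    define H where "H = (1 / 2) *\<^sub>R outer b"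
    define E' where "E' = boost_block b - (mat 1 + H)"
    define T where "T = boost_symbol bs"
    define E where "E = composite (map boost_block bs) - T"
    have M2: "M\<^sup>2 \<le> 1 / 4"
      using power_mono[OF M(2,1), of 2] by (simp add: power2_eq_square)
    have M4: "M ^ 4 = M\<^sup>2 * M\<^sup>2" "0 \<le> M ^ 4" using M by (simp_all flip: power_add)
    have "M ^ 4 \<le> 1 / 4 * (1 / 4)"
      unfolding M4(1) using M2 by (intro mult_mono) auto
    then have M4': "M ^ 4 \<le> 1 / 16" by simp
    have nb: "norm b \<le> M" and nbs: "\<And>b. b \<in> set bs \<Longrightarrow> norm b \<le> M"
      using cs(2) bs(1) by auto
    have H: "norm H \<le> M\<^sup>2 / 2"
      using nb by (simp add: H_def norm_outer power_mono)
    have E': "norm E' \<le> 2 * M ^ 4"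
      using boost_block_expansion[OF nb M(2)] by (simp add: E'_def H_def)
    have E: "norm E \<le> C * M ^ 4"
      using C(2)[OF bs(2) nbs M] by (simp add: E_def T_def)
    have T1: "norm (T - mat 1) \<le> m / 2 * M\<^sup>2"
      using norm_boost_symbol[of bs M] nbs bs(2) by (simp add: T_def)
    have "norm T \<le> norm (mat 1 :: real^'d^'d) + norm (T - mat 1)"
      using norm_triangle_ineq[of "mat 1" "T - mat 1"] by simp
    also have "\<dots> \<le> N + m / 2 * M\<^sup>2" using T1 by (simp add: N_def)
    also have "m / 2 * M\<^sup>2 \<le> m * 1" using M2 by (simp add: mult_mono field_simps)
    finally have T: "norm T \<le> N + m" by simp
    have "composite (map boost_block cs) - boost_symbol cs = (mat 1 + H + E') ** (T + E) - (T + H)"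
      by (simp add: bs(1) E'_def E_def H_def T_def boost_symbol_def scaleR_right_distrib)
    \<comment> \<open>\<open>H\<close> and \<open>T - mat 1\<close> are both of second order, so
      their product, where the order of the boosts first matters, is of order 4.\<close>
    also have "\<dots> = H ** (T - mat 1) + E + (H + E') ** E + E' ** T"
      by (simp add: matrix_add_ldistrib matrix_add_rdistrib matrix_diff_ldistrib)
    also have "norm \<dots> \<le> norm (H ** (T - mat 1)) + norm E + norm ((H + E') ** E) + norm (E' ** T)"
      by (intro order_trans[OF norm_triangle_ineq] add_mono order_refl)
    also have "norm (H ** (T - mat 1)) \<le> M\<^sup>2 / 2 * (m / 2 * M\<^sup>2)"
      by (intro order_trans[OF norm_matrix_mult_le] mult_mono H T1) auto
    also have "norm ((H + E') ** E) \<le> 1 * (C * M ^ 4)"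
    proof (intro order_trans[OF norm_matrix_mult_le] mult_mono E)
      show "norm (H + E') \<le> 1"
        using norm_triangle_ineq[of H E'] H E' M2 M4' by linarith
    qed auto
    also have "norm (E' ** T) \<le> 2 * M ^ 4 * (N + m)"
      by (intro order_trans[OF norm_matrix_mult_le] mult_mono E' T) (use M4 in auto)
    also have "M\<^sup>2 / 2 * (m / 2 * M\<^sup>2) + norm E + 1 * (C * M ^ 4) + 2 * M ^ 4 * (N + m) \<le> C' * M ^ 4"
      using E unfolding C'_def M4(1) by (simp add: algebra_simps)
    finally show ?thesis by simp
  qed
  moreover have "C' \<ge> 0" using C N by (simp add: C'_def)
  ultimately show ?case by blast
qed

text \<open>
  The holonomy rotation is the orthogonal polar factor of the product \<open>S\<close> of the boost blocks.
  If \<open>S\<close> is close to a symmetric \<open>T \<ge> 1\<close>, then \<open>P = (S\<^sup>T S)\<^sup>1\<^sup>/\<^sup>2\<close> is close to \<open>T\<close>, and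
  \<open>(R - 1) T = R (T - P) + (S - T)\<close> is small.
\<close>

lemma polar_factor_near_identity:
  fixes R P S T :: "real^'n^'n"
  assumes R: "orthogonal_matrix R" and P: "pos_def P" and S: "S = R ** P"
    and T: "transpose T = T" "\<And>x. 1 * (norm x)\<^sup>2 \<le> x \<bullet> (T *v x)"
  shows "norm (R - mat 1) \<le> (2 * norm T + norm (S - T) + 1) * norm (S - T)"
proof -
  define E where "E = S - T"
  have Se: "S = T + E" by (simp add: E_def)
  have tP: "transpose P = P" using P by (simp add: pos_def_def)
  have "transpose S ** S = P ** (transpose R ** R) ** P"
    unfolding S by (simp only: matrix_transpose_mul tP matrix_mul_assoc)
  then have PP: "P ** P = transpose S ** S"
    using R by (simp add: orthogonal_matrix_def)
  have "P ** P - T ** T = T ** E + transpose E ** T + transpose E ** E"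
    unfolding PP unfolding Se by (simp add: transpose_add T matrix_add_ldistrib matrix_add_rdistrib)
  then have "norm (P ** P - T ** T) \<le> norm (T ** E) + norm (transpose E ** T) + norm (transpose E ** E)"
    by (simp only:) (intro order_trans[OF norm_triangle_ineq] add_mono order_refl)
  also have "\<dots> \<le> norm T * norm E + norm E * norm T + norm E * norm E"
    by (intro add_mono order_trans[OF norm_matrix_mult_le]) (simp_all add: norm_transpose)
  finally have F: "norm (P ** P - T ** T) \<le> norm T * norm E + norm E * norm T + norm E * norm E" .
  \<comment> \<open>Coercivity is drawn from \<open>T\<close> alone, so that the bound does not
    involve the smallest eigenvalue of \<open>P\<close>.\<close>
  have "(0 + 1) * norm (P - T) \<le> norm (P ** P - T ** T)"
  proof (rule sqrt_perturbation[OF T(1) _ T(2)])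
    show "0 * (norm x)\<^sup>2 \<le> x \<bullet> (P *v x)" for x
      using P by (cases "x = 0") (auto simp: pos_def_def less_imp_le)
  qed
  with F have PT: "norm (P - T) \<le> (2 * norm T + norm E) * norm E"
    by (simp add: algebra_simps)
  have "norm (R *v x) \<le> 1 * norm x" for x
    using R by (simp add: orthogonal_transformation_norm orthogonal_transformation_matrix)
  then have RX: "norm (R ** (T - P)) \<le> norm (T - P)"
    using norm_matrix_mult_left_le[of R 1] by simp
  have "(R - mat 1) ** T = R ** (T - P) + E"
    by (simp add: matrix_diff_ldistrib matrix_diff_rdistrib E_def S)
  then have "norm ((R - mat 1) ** T) \<le> norm (P - T) + norm E"
    using norm_triangle_ineq[of "R ** (T - P)" E] RX by (simp add: norm_minus_commute)
  \<comment> \<open>Since \<open>T\<close> is at least the identity, multiplication by it cannot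
    shrink the Frobenius norm.\<close>
  moreover have "norm (R - mat 1) \<le> norm ((R - mat 1) ** T)"
  proof (cases "R = mat 1")
    case False
    have "1 * (norm (R - mat 1))\<^sup>2 \<le> (R - mat 1) \<bullet> ((R - mat 1) ** T)"
      by (rule inner_matrix_mult_right_ge[OF T])
    also have "\<dots> \<le> norm (R - mat 1) * norm ((R - mat 1) ** T)"
      by (rule norm_cauchy_schwarz)
    finally show ?thesis using False by (simp add: power2_eq_square)
  qed simp
  ultimately show ?thesis
    using PT by (simp add: E_def algebra_simps)
qed

subsection \<open>Loops\<close>

lemma rho_pos: "endpoint c W v C \<Longrightarrow> rho c W > 0"
  by (simp add: endpoint_def rho_def)

lemma loop_holonomy:
  assumes c: "c > 0" and adm: "\<forall>(u, E) \<in> set steps. admissible_medium u E"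
    and W: "W = composite (map (\<lambda>(u, E). w3 c u E) steps)" and e: "endpoint c W v C"
  shows "\<exists>R. rotation_matrix R \<and> holonomy c W v C = rho c W *\<^sub>R block_matrix 1 0 0 R"
proof -
  have "\<And>u E. (u, E) \<in> set steps \<Longrightarrow> admissible_medium u E" using adm by auto
  from composite_w3_block[OF c this, of steps] obtain a r S
    where "a > 0" "W = block_matrix a r 0 S" "det S > 0"
    unfolding W by metis
  then show ?thesis using holonomy_rotation c e by metis
qed

lemma loop_directivity:
  fixes R :: "real^'d^'d"
  assumes "CARD('d) = 3" "rotation_matrix R" "endpoint c W v C"
    and "holonomy c W v C = rho c W *\<^sub>R block_matrix 1 0 0 R" "stationary_source M s"
  shows "directivity K c M (transport (rho c W) (holonomy c W v C) s) n \<omega> =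
    directivity K c M s (transpose R *v n) (rho c W * \<omega>)"
  using assms rho_pos by (intro directivity_transport) auto

section \<open>Anisotropy loops\<close>

lemma w3_zero_velocity: "w3 c 0 E = block_matrix 1 0 0 (c *\<^sub>R matrix_inv (pd_sqrt E))"
  by (simp add: w3_def)

lemma admissible_zero_velocity: "pos_def E \<Longrightarrow> admissible_medium 0 E"
  by (simp add: admissible_medium_def pos_def_def)

lemma composite_zero_velocity:
  "composite (map (w3 c 0) Cs) =
     block_matrix 1 0 0 (composite (map (\<lambda>E. c *\<^sub>R matrix_inv (pd_sqrt E)) Cs))"
  by (induction Cs rule: rev_induct) (simp_all add: mat_1_block w3_zero_velocity block_upper_mult)

text \<open>\<open>W\<close> is block diagonal with time entry 1, so \<open>Q_end c W\<close> has
  time entry 1 and no mixed terms: the endpoint has velocity 0 and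
  \<open>C = c^2 S^(-1) S^(-T)\<close>. Admissibility of the endpoint is thus a conclusion for these
  loops.\<close>

lemma anisotropy_endpoint:
  assumes c: "c > 0" and Cs: "\<forall>E\<in>set Cs. pos_def E" and W: "W = composite (map (w3 c 0) Cs)"
  shows "q00 c W = 1" "\<exists>v C. endpoint c W v C"
proof -
  define S where "S = composite (map (\<lambda>E. c *\<^sub>R matrix_inv (pd_sqrt E)) Cs)"
  have "det S > 0"
    using c Cs unfolding S_def by (intro det_composite_pos) (auto intro!: pos_def_det pos_def_w3_block)
  then obtain S' where S': "S ** S' = mat 1"
    by (metis invertible_def invertible_det_nz less_irrefl)
  have "matrix_inv W = block_matrix 1 0 0 S'"
    using block_upper_inverse[OF _ S', of 1 0]
    by (intro matrix_inv_eqI) (simp add: W composite_zero_velocity S_def[symmetric])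
  then have Qe: "Q_end c W = block_matrix 1 0 0 (- (c\<^sup>2 *\<^sub>R (S' ** transpose S')))"
    unfolding Q_end_def Q_star_def mat_eq_scaleR[of "c\<^sup>2"] scaleR_minus_left[symmetric]
    by (simp add: transpose_block_matrix block_upper_mult del: scaleR_minus_left)
  then show q: "q00 c W = 1" by (simp add: q00_def)
  have "x \<bullet> ((S' ** transpose S') *v x) > 0" if "x \<noteq> 0" for x
  proof -
    have "transpose S ** (transpose (S')) = mat 1"
      using S' by (metis matrix_left_right_inverse matrix_transpose_mul transpose_mat)
    then have "transpose S' *v x \<noteq> 0"
      using that by (metis matrix_vector_mul_assoc matrix_vector_mul_lid matrix_vector_mult_0_right)
    then have "(transpose S' *v x) \<bullet> (transpose S' *v x) > 0" by simp
    then show ?thesis by (simp add: dot_lmul_matrix flip: matrix_vector_mul_assoc)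
  qed
  then have "pos_def (S' ** transpose S')"
    by (simp add: pos_def_def matrix_transpose_mul)
  then have "pos_def (c\<^sup>2 *\<^sub>R (S' ** transpose S'))"
    using c by (intro pos_def_scaleR) auto
  then have "endpoint c W 0 (c\<^sup>2 *\<^sub>R (S' ** transpose S'))"
    by (simp add: endpoint_def q admissible_zero_velocity Qe Q_matrix_def)
  then show "\<exists>v C. endpoint c W v C" by blast
qed

text \<open>\<open>B\<close> is fixed before the loop and its endpoint: the product expansion bounds
  the distance of \<open>S\<close> from its symbol, and the polar comparison passes this bound on to
  \<open>R\<close>.\<close>

lemma boost_loop_rotation_bound:
  fixes c :: real
  assumes c: "c > 0"
  shows "\<exists>B. \<forall>(us :: (real^'d) list) W v C M R.
    length us = m \<and> (\<forall>u\<in>set us. norm u < c \<and> norm u / c \<le> M) \<and> 0 \<le> M \<and> M \<le> 1 / 2 \<and>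
    W = composite (map (boost c) us) \<and> endpoint c W v C \<and> rotation_matrix R \<and>
    holonomy c W v C = rho c W *\<^sub>R block_matrix 1 0 0 R \<longrightarrow>
    norm (R - mat 1) \<le> B * M ^ 4"
proof -
  obtain K where K: "K \<ge> 0" "\<And>(bs :: (real^'d) list) M. length bs = m \<Longrightarrow>
      (\<And>b. b \<in> set bs \<Longrightarrow> norm b \<le> M) \<Longrightarrow> 0 \<le> M \<Longrightarrow> M \<le> 1 / 2 \<Longrightarrow>
      norm (composite (map boost_block bs) - boost_symbol bs) \<le> K * M ^ 4"
    using boost_product_expansion[where 'd = 'd, of m] by metis
  define N where "N = norm (mat 1 :: real^'d^'d)"
  show ?thesis
  \<comment> \<open>The witness is the polar bound with \<open>norm T \<le> N + m\<close> and
    \<open>norm (S - T) \<le> K * M ^ 4 \<le> K\<close>.\<close>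
  proof (intro exI[of _ "(2 * (N + m) + K + 1) * K"] allI impI, elim conjE)
    fix us :: "(real^'d) list" and W v C M R
    assume us: "length us = m" "\<forall>u\<in>set us. norm u < c \<and> norm u / c \<le> M"
      and M: "0 \<le> M" "M \<le> 1 / 2" and W: "W = composite (map (boost c) us)"
      and e: "endpoint c W v C" and R: "rotation_matrix R"
      and D: "holonomy c W v C = rho c W *\<^sub>R block_matrix 1 0 0 R"
    define steps where "steps = map (\<lambda>u. (u, mat (c\<^sup>2) :: real^'d^'d)) us"
    define bs where "bs = map (\<lambda>u. (1 / c) *\<^sub>R u) us"
    define S where "S = composite (map boost_block bs)"
    have bs: "length bs = m" "\<And>b. b \<in> set bs \<Longrightarrow> norm b \<le> M"
      using us c by (auto simp: bs_def)
    have adm: "\<And>u E. (u, E) \<in> set steps \<Longrightarrow> admissible_medium u E"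
      using us(2) c by (auto simp: steps_def intro!: admissible_boost)
    have W': "composite (map (\<lambda>(u, E). w3 c u E) steps) = W"
      by (simp add: W steps_def comp_def boost_def[abs_def])
    have S': "composite (map (\<lambda>(u, E). c *\<^sub>R matrix_inv (pd_sqrt (E - outer u))) steps) = S"
      using us(2) c unfolding S_def bs_def steps_def
      by (auto simp: comp_def boost_spatial_block intro!: arg_cong[of _ _ composite])
    obtain a r where "W = block_matrix a r 0 S"
      using composite_w3_block[OF c adm, of steps] unfolding W' S' by metis
    moreover have adm': "admissible_medium v C" using e by (simp add: endpoint_def)
    ultimately have SP: "S = R ** ((rho c W * c) *\<^sub>R matrix_inv (pd_sqrt (C - outer v)))"
      using holonomy_spatial_block[OF c adm' _ D] by blast
    have P: "pos_def ((rho c W * c) *\<^sub>R matrix_inv (pd_sqrt (C - outer v)))"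
      using adm' c rho_pos[OF e] by (intro pos_def_w3_block) (auto simp: admissible_medium_def)
    have E: "norm (S - boost_symbol bs) \<le> K * M ^ 4"
      unfolding S_def by (rule K(2)[OF bs M])
    have M4: "0 \<le> M ^ 4" "M ^ 4 \<le> 1" and M2: "M\<^sup>2 \<le> 1"
      using M by (auto intro!: power_le_one)
    have "norm (boost_symbol bs) \<le> N + norm (boost_symbol bs - mat 1)"
      using norm_triangle_ineq[of "mat 1" "boost_symbol bs - mat 1"] by (simp add: N_def)
    also have "\<dots> \<le> N + m / 2 * M\<^sup>2"
      using norm_boost_symbol[of bs M] bs by simp
    also have "m / 2 * M\<^sup>2 \<le> m / 2 * 1" using M2 by (intro mult_left_mono) auto
    finally have T: "norm (boost_symbol bs) \<le> N + m" by simp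
    have E1: "norm (S - boost_symbol bs) \<le> K"
      using E mult_left_mono[OF M4(2) K(1)] by simp
    have "norm (R - mat 1) \<le> (2 * norm (boost_symbol bs) + norm (S - boost_symbol bs) + 1) *
        norm (S - boost_symbol bs)"
      using R by (intro polar_factor_near_identity[OF _ P SP transpose_boost_symbol boost_symbol_ge_1])
        (simp add: rotation_matrix_def)
    also have "\<dots> \<le> (2 * (N + m) + K + 1) * (K * M ^ 4)"
      using T E E1 K(1) by (intro mult_mono) (auto simp: N_def)
    finally show "norm (R - mat 1) \<le> (2 * (N + m) + K + 1) * K * M ^ 4"
      by (simp add: mult.assoc)
  qed
qed

text \<open>Converts closeness of \<open>R\<close> to the identity into closeness of patterns: the
  rotation moves a unit vector along the sphere by at most \<open>norm (R - mat 1)\<close>.\<close>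

lemma lipschitz_rotation_bound:
  fixes R :: "real^'d^'d" and f :: "real^'d \<Rightarrow> real"
  assumes "L-lipschitz_on (sphere 0 1) f" "orthogonal_matrix R" "norm n = 1"
  shows "\<bar>f (transpose R *v n) - f n\<bar> \<le> L * norm (R - mat 1)"
proof -
  have "norm (transpose R *v n) = 1"
    using assms(2,3) by (simp add: orthogonal_transformation_norm orthogonal_transformation_matrix
        orthogonal_matrix_transpose del: transpose_matrix_vector)
  then have "\<bar>f (transpose R *v n) - f n\<bar> \<le> L * norm (transpose R *v n - n)"
    using lipschitz_onD[OF assms(1), of "transpose R *v n" n] assms(3) by (simp add: dist_norm)
  also have "transpose R *v n - n = transpose (R - mat 1) *v n"
    by (simp only: transpose_diff transpose_mat matrix_vector_mult_diff_rdistrib matrix_vector_mul_lid)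
  also have "norm \<dots> \<le> norm (R - mat 1)"
    using norm_matrix_vector_mult_le[of "transpose (R - mat 1)" n] assms(3)
    by (simp add: norm_transpose del: transpose_matrix_vector)
  finally show ?thesis
    using lipschitz_on_nonneg[OF assms(1)] by (simp add: mult_left_mono)
qed

text \<open>The order of the quantifiers carries the meaning of \<open>O(M^4)\<close>: for given
  \<open>c\<close> and dimension, \<open>B\<close> and \<open>\<delta>\<close> are chosen from the
  number of boosts, uniformly over all loops and sources.\<close>

theorem corollary36:
  fixes c :: real
  assumes c: "c > 0"
  shows
    \<comment> \<open>every loop: form of the holonomy, and its action on directivities\<close>
    "(\<forall>(steps :: ((real^'d) \<times> (real^'d^'d)) list) W v C.
        (\<forall>(u, E) \<in> set steps. admissible_medium u E) \<and>
        W = composite (map (\<lambda>(u, E). w3 c u E) steps) \<and>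
        endpoint c W v C \<longrightarrow>
        (\<exists>R. rotation_matrix R \<and>
             holonomy c W v C = rho c W *\<^sub>R block_matrix 1 0 0 R \<and>
             (CARD('d) = 3 \<longrightarrow>
               (\<forall>(M :: 'w measure) s K n \<omega>.
                  stationary_source M s \<and> K > 0 \<and> norm n = 1 \<longrightarrow>
                  directivity K c M (transport (rho c W) (holonomy c W v C) s) n \<omega> =
                  directivity K c M s (transpose R *v n) (rho c W * \<omega>)))))
   \<and>
    \<comment> \<open>(i) anisotropy loops\<close>
     (\<forall>(Cs :: (real^'d^'d) list) W.
        (\<forall>E \<in> set Cs. pos_def E) \<and>
        W = composite (map (w3 c 0) Cs) \<longrightarrow>
        (\<forall>E \<in> set Cs. row None (w3 c 0 E) = axis None 1) \<and>
        (\<exists>v C. endpoint c W v C) \<and>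
        rho c W = 1 \<and>
        (\<forall>v C. endpoint c W v C \<longrightarrow>
           (\<exists>R. rotation_matrix R \<and>
                holonomy c W v C = block_matrix 1 0 0 R \<and>
                (CARD('d) = 3 \<longrightarrow>
                  (\<forall>(M :: 'w measure) s K n \<omega>.
                     stationary_source M s \<and> K > 0 \<and> norm n = 1 \<longrightarrow>
                     directivity K c M (transport (rho c W) (holonomy c W v C) s) n \<omega> =
                     directivity K c M s (transpose R *v n) \<omega>)))))
   \<and>
    \<comment> \<open>(ii) boost loops\<close>
     (\<forall>m \<ge> (1::nat). \<exists>B \<delta>. \<delta> > 0 \<and>
        (\<forall>(us :: (real^'d) list) W v C Mach.
           length us = m \<and> (\<forall>u \<in> set us. norm u < c) \<and>
           W = composite (map (boost c) us) \<and>
           endpoint c W v C \<and>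
           Mach = Max ((\<lambda>u. norm u / c) ` set us) \<and> Mach < \<delta> \<longrightarrow>
           (\<exists>R. rotation_matrix R \<and>
                holonomy c W v C = rho c W *\<^sub>R block_matrix 1 0 0 R \<and>
                norm (R - mat 1) \<le> B * Mach ^ 4 \<and>
                (CARD('d) = 3 \<longrightarrow>
                  (\<forall>(M :: 'w measure) s K n \<omega>.
                     stationary_source M s \<and> K > 0 \<and> norm n = 1 \<longrightarrow>
                     directivity K c M (transport (rho c W) (holonomy c W v C) s) n \<omega> =
                     directivity K c M s (transpose R *v n) (rho c W * \<omega>) \<and>
                     (\<forall>L. L-lipschitz_on (sphere 0 1) (\<lambda>e. directivity K c M s e (rho c W * \<omega>)) \<longrightarrow>
                        \<bar>directivity K c M (transport (rho c W) (holonomy c W v C) s) n \<omega> -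
                         directivity K c M s n (rho c W * \<omega>)\<bar> \<le> L * B * Mach ^ 4))))))"
proof (intro conjI, goal_cases)
  case 1
  show ?case
  proof (intro allI impI)
    fix steps :: "((real^'d) \<times> (real^'d^'d)) list" and W v C
    assume *: "(\<forall>(u, E) \<in> set steps. admissible_medium u E) \<and>
      W = composite (map (\<lambda>(u, E). w3 c u E) steps) \<and> endpoint c W v C"
    then obtain R where "rotation_matrix R" "holonomy c W v C = rho c W *\<^sub>R block_matrix 1 0 0 R"
      using loop_holonomy[OF c] by blast
    then show "\<exists>R. rotation_matrix R \<and>
        holonomy c W v C = rho c W *\<^sub>R block_matrix 1 0 0 R \<and>
        (CARD('d) = 3 \<longrightarrow>
          (\<forall>(M :: 'w measure) s K n \<omega>.
             stationary_source M s \<and> K > 0 \<and> norm n = 1 \<longrightarrow>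
             directivity K c M (transport (rho c W) (holonomy c W v C) s) n \<omega> =
             directivity K c M s (transpose R *v n) (rho c W * \<omega>)))"
      using * loop_directivity by blast
  qed
next
  case 2
  show ?case
  proof (intro allI impI, elim conjE, intro conjI)
    fix Cs :: "(real^'d^'d) list" and W
    assume Cs: "\<forall>E\<in>set Cs. pos_def E" and W: "W = composite (map (w3 c 0) Cs)"
    show "\<forall>E\<in>set Cs. row None (w3 c 0 E) = axis None 1"
      by (simp add: w3_zero_velocity row_def option_vec_eq_iff axis_def)
    show "\<exists>v C. endpoint c W v C"
      using anisotropy_endpoint[OF c Cs W] by blast
    show rho: "rho c W = 1"
      using anisotropy_endpoint(1)[OF c Cs W] by (simp add: rho_def)
    show "\<forall>v C. endpoint c W v C \<longrightarrow>
        (\<exists>R. rotation_matrix R \<and> holonomy c W v C = block_matrix 1 0 0 R \<and>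
          (CARD('d) = 3 \<longrightarrow>
            (\<forall>(M :: 'w measure) s K n \<omega>.
               stationary_source M s \<and> K > 0 \<and> norm n = 1 \<longrightarrow>
               directivity K c M (transport (rho c W) (holonomy c W v C) s) n \<omega> =
               directivity K c M s (transpose R *v n) \<omega>)))"
    proof (intro allI impI)
      fix v C assume e: "endpoint c W v C"
      \<comment> \<open>An anisotropy loop is a general loop whose steps all have velocity
        0.\<close>
      have "W = composite (map (\<lambda>(u, E). w3 c u E) (map (Pair 0) Cs))"
        by (simp add: W comp_def)
      moreover have "\<forall>(u, E)\<in>set (map (Pair 0) Cs). admissible_medium u E"
        using Cs by (auto intro: admissible_zero_velocity)
      ultimately obtain R where R: "rotation_matrix R"
        "holonomy c W v C = rho c W *\<^sub>R block_matrix 1 0 0 R"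
        using loop_holonomy[OF c _ _ e] by blast
      have "directivity K c M (transport (rho c W) (holonomy c W v C) s) n \<omega> =
          directivity K c M s (transpose R *v n) \<omega>"
        if "CARD('d) = 3" "stationary_source M s" for M :: "'w measure" and s K n \<omega>
        using loop_directivity[OF that(1) R(1) e R(2) that(2)] rho by simp
      then show "\<exists>R. rotation_matrix R \<and> holonomy c W v C = block_matrix 1 0 0 R \<and>
          (CARD('d) = 3 \<longrightarrow>
            (\<forall>(M :: 'w measure) s K n \<omega>.
               stationary_source M s \<and> K > 0 \<and> norm n = 1 \<longrightarrow>
               directivity K c M (transport (rho c W) (holonomy c W v C) s) n \<omega> =
               directivity K c M s (transpose R *v n) \<omega>))"
        using R rho by (intro exI[of _ R]) simp
    qed
  qed
next
  case 3
  show ?case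
  proof (intro allI impI)
    fix m :: nat assume m: "m \<ge> 1"
    obtain B where B: "\<And>(us :: (real^'d) list) W v C M R.
        length us = m \<Longrightarrow> \<forall>u\<in>set us. norm u < c \<and> norm u / c \<le> M \<Longrightarrow> 0 \<le> M \<Longrightarrow> M \<le> 1 / 2 \<Longrightarrow>
        W = composite (map (boost c) us) \<Longrightarrow> endpoint c W v C \<Longrightarrow> rotation_matrix R \<Longrightarrow>
        holonomy c W v C = rho c W *\<^sub>R block_matrix 1 0 0 R \<Longrightarrow>
        norm (R - mat 1) \<le> B * M ^ 4"
      using boost_loop_rotation_bound[OF c, where 'd = 'd, of m] by metis
    show "\<exists>B \<delta>. \<delta> > 0 \<and>
        (\<forall>(us :: (real^'d) list) W v C Mach.
           length us = m \<and> (\<forall>u \<in> set us. norm u < c) \<and>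
           W = composite (map (boost c) us) \<and>
           endpoint c W v C \<and>
           Mach = Max ((\<lambda>u. norm u / c) ` set us) \<and> Mach < \<delta> \<longrightarrow>
           (\<exists>R. rotation_matrix R \<and>
                holonomy c W v C = rho c W *\<^sub>R block_matrix 1 0 0 R \<and>
                norm (R - mat 1) \<le> B * Mach ^ 4 \<and>
                (CARD('d) = 3 \<longrightarrow>
                  (\<forall>(M :: 'w measure) s K n \<omega>.
                     stationary_source M s \<and> K > 0 \<and> norm n = 1 \<longrightarrow>
                     directivity K c M (transport (rho c W) (holonomy c W v C) s) n \<omega> =
                     directivity K c M s (transpose R *v n) (rho c W * \<omega>) \<and>
                     (\<forall>L. L-lipschitz_on (sphere 0 1) (\<lambda>e. directivity K c M s e (rho c W * \<omega>)) \<longrightarrow>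
                        \<bar>directivity K c M (transport (rho c W) (holonomy c W v C) s) n \<omega> -
                         directivity K c M s n (rho c W * \<omega>)\<bar> \<le> L * B * Mach ^ 4)))))"
    \<comment> \<open>The radius \<open>1 / 2\<close> is the range in which the expansion of a
      single boost block was established.\<close>
    proof (intro exI[of _ B] exI[of _ "1 / 2"] conjI allI impI, simp, elim conjE)
      fix us :: "(real^'d) list" and W v C Mach
      assume us: "length us = m" "\<forall>u\<in>set us. norm u < c" and W: "W = composite (map (boost c) us)"
        and e: "endpoint c W v C" and Mach: "Mach = Max ((\<lambda>u. norm u / c) ` set us)" "Mach < 1 / 2"
      have le: "norm u / c \<le> Mach" if "u \<in> set us" for u
        using that unfolding Mach(1) by (intro Max_ge) auto
      \<comment> \<open>Here \<open>m \<ge> 1\<close> enters: \<open>Max\<close> is taken over a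
        nonempty set, hence nonnegative.\<close>
      obtain u where "u \<in> set us"
        using m us(1) by (cases us) auto
      then have "0 \<le> Mach"
        using le[of u] c by (meson divide_nonneg_pos norm_ge_zero order_trans)
      have "W = composite (map (\<lambda>(u, E). w3 c u E) (map (\<lambda>u. (u, mat (c\<^sup>2))) us))"
        by (simp add: W comp_def boost_def[abs_def])
      moreover have "\<forall>(u, E)\<in>set (map (\<lambda>u. (u, mat (c\<^sup>2))) us). admissible_medium u E"
        using us(2) c by (auto intro: admissible_boost)
      ultimately obtain R where R: "rotation_matrix R"
        "holonomy c W v C = rho c W *\<^sub>R block_matrix 1 0 0 R"
        using loop_holonomy[OF c _ _ e] by blast
      have RB: "norm (R - mat 1) \<le> B * Mach ^ 4"
        using us le \<open>0 \<le> Mach\<close> Mach(2) by (intro B[OF _ _ _ _ W e R]) auto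
      have dir: "directivity K c M (transport (rho c W) (holonomy c W v C) s) n \<omega> =
          directivity K c M s (transpose R *v n) (rho c W * \<omega>)"
        if "CARD('d) = 3" "stationary_source M s" for M :: "'w measure" and s K n \<omega>
        by (rule loop_directivity[OF that(1) R(1) e R(2) that(2)])
      have "\<bar>directivity K c M s (transpose R *v n) (rho c W * \<omega>) - directivity K c M s n (rho c W * \<omega>)\<bar>
          \<le> L * B * Mach ^ 4"
        if "norm n = 1" and L: "L-lipschitz_on (sphere 0 1) (\<lambda>e. directivity K c M s e (rho c W * \<omega>))"
        for M :: "'w measure" and s K n \<omega> L
      proof -
        have "\<bar>directivity K c M s (transpose R *v n) (rho c W * \<omega>) - directivity K c M s n (rho c W * \<omega>)\<bar>
            \<le> L * norm (R - mat 1)"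
          using lipschitz_rotation_bound[OF L _ that(1)] R(1) by (simp add: rotation_matrix_def)
        also have "\<dots> \<le> L * (B * Mach ^ 4)"
          using RB lipschitz_on_nonneg[OF L] by (rule mult_left_mono)
        finally show ?thesis by (simp only: mult.assoc)
      qed
      with R RB dir show "\<exists>R. rotation_matrix R \<and>
          holonomy c W v C = rho c W *\<^sub>R block_matrix 1 0 0 R \<and>
          norm (R - mat 1) \<le> B * Mach ^ 4 \<and>
          (CARD('d) = 3 \<longrightarrow>
            (\<forall>(M :: 'w measure) s K n \<omega>.
               stationary_source M s \<and> K > 0 \<and> norm n = 1 \<longrightarrow>
               directivity K c M (transport (rho c W) (holonomy c W v C) s) n \<omega> =
               directivity K c M s (transpose R *v n) (rho c W * \<omega>) \<and>
               (\<forall>L. L-lipschitz_on (sphere 0 1) (\<lambda>e. directivity K c M s e (rho c W * \<omega>)) \<longrightarrow>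
                  \<bar>directivity K c M (transport (rho c W) (holonomy c W v C) s) n \<omega> -
                   directivity K c M s n (rho c W * \<omega>)\<bar> \<le> L * B * Mach ^ 4)))"
        by (intro exI[of _ R]) (simp only:, simp)
    qed
  qed
qed

end
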